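(* Let $p$ be a prime number and let $F$ be either the rational function field $\mathbb{F}_p(\alpha,\beta)$ in two independent variables $\alpha,\beta$ over the field $\mathbb{F}_p$ with $p$ elements, or the iterated Laurent series field $\mathbb{F}_p((\alpha))((\beta))$. Then the algebras $[1,\alpha)_{p,F}$ and $[1,\beta)_{p,F}$ are not right linked.
   Context: For a field $F$ of characteristic $p$, $a \in F$ and $b \in F^\times$, the symbol $[a,b)_{p,F}$ denotes the $F$-algebra generated by $x$ and $y$ subject to the relations $x^p-x=a$, $y^p=b$ and $yxy^{-1}=x+1$; it is a central simple algebra of degree $p$ over $F$. Two algebras $A, A'$ over $F$ are right linked if there exist $a,c\in F$ and $b\in F^\times$ such that $A\cong[a,b)_{p,F}$ and $A'\cong[c,b)_{p,F}$ as $F$-algebras. *)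

theory Defs
  imports
    "HOL-Library.Poly_Mapping"
    "HOL-Computational_Algebra.Computational_Algebra"
    "HOL-Algebra.QuotRing"
    "HOL-Algebra.Module"
begin

hide_const (open) Polynomial.smult

subsection \<open>Words and the free associative algebra\<close>

datatype 'g free_monoid = Word "'g list"

fun letters :: "'g free_monoid \<Rightarrow> 'g list" where
  "letters (Word w) = w"

text \<open>
  The monoid of words is written additively because multiplication of
  \<^typ>\<open>'m \<Rightarrow>\<^sub>0 'f\<close> is convolution along \<open>+\<close> on \<open>'m\<close>.
  Hence \<^typ>\<open>'g free_monoid \<Rightarrow>\<^sub>0 'f\<close> is the free associative unital
  algebra over \<open>'f\<close> on the set of all elements of type \<open>'g\<close>.
\<close>

instantiation free_monoid :: (type) monoid_add
begin

definition zero_free_monoid :: "'a free_monoid" where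
  "0 = Word []"

definition plus_free_monoid :: "'a free_monoid \<Rightarrow> 'a free_monoid \<Rightarrow> 'a free_monoid" where
  "u + v = Word (letters u @ letters v)"

instance
proof
  fix u v w :: "'a free_monoid"
  show "u + v + w = u + (v + w)" by (simp add: plus_free_monoid_def)
  show "0 + u = u" by (cases u) (simp add: plus_free_monoid_def zero_free_monoid_def)
  show "u + 0 = u" by (cases u) (simp add: plus_free_monoid_def zero_free_monoid_def)
qed

end

type_synonym ('g, 'f) free_alg = "'g free_monoid \<Rightarrow>\<^sub>0 'f"

definition gen :: "'g \<Rightarrow> ('g, 'f::comm_ring_1) free_alg" where
  "gen g = Poly_Mapping.single (Word [g]) 1"

definition scalar :: "'f::comm_ring_1 \<Rightarrow> ('g, 'f) free_alg" where
  "scalar c = Poly_Mapping.single 0 c"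

definition free_algebra :: "('f::comm_ring_1, ('g, 'f) free_alg) module" where
  "free_algebra =
    \<lparr>carrier = UNIV, mult = (*), one = 1, zero = 0, add = (+), smult = (\<lambda>c f. scalar c * f)\<rparr>"

lemma free_algebra_simps [simp]:
  "carrier free_algebra = UNIV" "mult free_algebra = (*)" "one free_algebra = 1"
  "zero free_algebra = 0" "add free_algebra = (+)"
  "module.smult free_algebra = (\<lambda>c f. scalar c * f)"
  by (simp_all add: free_algebra_def)

lemma ring_free_algebra: "ring (free_algebra :: ('f::comm_ring_1, ('g, 'f) free_alg) module)"
proof (rule ringI)
  show "abelian_group (free_algebra :: ('f, ('g, 'f) free_alg) module)"
  proof (rule abelian_groupI)
    fix x :: "('g, 'f) free_alg"
    show "\<exists>y\<in>carrier free_algebra. y \<oplus>\<^bsub>free_algebra\<^esub> x = \<zero>\<^bsub>free_algebra\<^esub>"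
      by (intro bexI[of _ "- x"]) auto
  qed (auto simp: add_ac)
  show "Group.monoid (free_algebra :: ('f, ('g, 'f) free_alg) module)"
    by (rule monoidI) (auto simp: mult.assoc)
qed (auto simp: algebra_simps)


subsection \<open>Algebras given by generators and relations\<close>

text \<open>
  The quotient by the two-sided ideal generated by \<open>S\<close>; the scalar \<open>c\<close> acts as
  multiplication by the class of \<open>scalar c\<close>.
\<close>

definition presented_algebra ::
  "('g, 'f::comm_ring_1) free_alg set \<Rightarrow> ('f, ('g, 'f) free_alg set) module" where
  "presented_algebra S =
    (let I = genideal free_algebra S; Q = free_algebra Quot I in
      \<lparr>carrier = carrier Q, mult = mult Q, one = one Q, zero = zero Q, add = add Q,
       smult = (\<lambda>c X. (I +>\<^bsub>free_algebra\<^esub> scalar c) \<otimes>\<^bsub>Q\<^esub> X)\<rparr>)"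

definition algebra_iso ::
  "('f, 'v, 'm) module_scheme \<Rightarrow> ('f, 'w, 'n) module_scheme \<Rightarrow> bool" where
  "algebra_iso A B \<longleftrightarrow>
    (\<exists>h \<in> ring_iso A B. \<forall>c. \<forall>v \<in> carrier A. h (c \<odot>\<^bsub>A\<^esub> v) = c \<odot>\<^bsub>B\<^esub> h v)"


subsection \<open>Symbol algebras\<close>

datatype xy = GenX | GenY

text \<open>
  Since \<open>y\<^sup>p = b\<close> is a unit, \<open>y\<close> is invertible in the quotient, so the relation
  \<open>y x y\<^sup>-\<^sup>1 = x + 1\<close> is the relation \<open>y x = (x + 1) y\<close>;
  see \<open>p_symbol_relations\<close> below. Only \<open>p\<close> equal to the
  (prime) characteristic and \<open>b \<noteq> 0\<close> are meaningful.
\<close>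

definition p_symbol_relators :: "nat \<Rightarrow> 'f::field \<Rightarrow> 'f \<Rightarrow> (xy, 'f) free_alg set" where
  "p_symbol_relators p a b =
    {gen GenX ^ p - gen GenX - scalar a,
     gen GenY ^ p - scalar b,
     gen GenY * gen GenX - (gen GenX + 1) * gen GenY}"

definition p_symbol :: "nat \<Rightarrow> 'f::field \<Rightarrow> 'f \<Rightarrow> ('f, (xy, 'f) free_alg set) module" where
  "p_symbol p a b = presented_algebra (p_symbol_relators p a b)"

definition right_linked ::
  "nat \<Rightarrow> ('f::field, 'v, 'm) module_scheme \<Rightarrow> ('f, 'w, 'n) module_scheme \<Rightarrow> bool" where
  "right_linked p A A' \<longleftrightarrow>
    (\<exists>a c b. b \<noteq> 0 \<and> algebra_iso A (p_symbol p a b) \<and> algebra_iso A' (p_symbol p c b))"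

definition p_symbol_class :: "nat \<Rightarrow> 'f::field \<Rightarrow> 'f \<Rightarrow> (xy, 'f) free_alg \<Rightarrow> (xy, 'f) free_alg set"
  where "p_symbol_class p a b f =
    genideal free_algebra (p_symbol_relators p a b) +>\<^bsub>free_algebra\<^esub> f"

lemma ideal_p_symbol_relators:
  "ideal (genideal free_algebra (p_symbol_relators p a b)) free_algebra"
  by (rule ring.genideal_ideal[OF ring_free_algebra]) simp

lemma p_symbol_simps:
  fixes a b :: "'f::field" and p :: nat
  defines "Q \<equiv> free_algebra Quot (genideal free_algebra (p_symbol_relators p a b))"
  shows "carrier (p_symbol p a b) = carrier Q" "mult (p_symbol p a b) = mult Q"
    "one (p_symbol p a b) = one Q" "zero (p_symbol p a b) = zero Q"
    "add (p_symbol p a b) = add Q"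
  by (simp_all add: p_symbol_def presented_algebra_def Let_def Q_def)

lemma ring_p_symbol: "ring (p_symbol p a b)"
proof -
  interpret Q: ring "free_algebra Quot (genideal free_algebra (p_symbol_relators p a b))"
    by (rule ideal.quotient_is_ring[OF ideal_p_symbol_relators])
  show ?thesis
  proof (rule ringI)
    show "abelian_group (p_symbol p a b)"
      by (rule abelian_groupI, unfold p_symbol_simps)
        (assumption | rule Q.a_closed Q.zero_closed Q.a_assoc Q.a_comm Q.l_zero Q.add.l_inv_ex)+
    show "Group.monoid (p_symbol p a b)"
      by (rule monoidI, unfold p_symbol_simps) (auto simp only: Q.m_assoc Q.l_one Q.r_one Q.m_closed Q.one_closed)
  qed (unfold p_symbol_simps, auto simp only: Q.l_distr Q.r_distr)
qed

lemma p_symbol_class_hom: "p_symbol_class p a b \<in> ring_hom free_algebra (p_symbol p a b)"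
  using ideal.rcos_ring_hom[OF ideal_p_symbol_relators, of p a b]
  by (simp add: ring_hom_def p_symbol_class_def p_symbol_simps Pi_def)

lemma p_symbol_class_simps:
  "p_symbol_class p a b f \<in> carrier (p_symbol p a b)"
  "p_symbol_class p a b (f * g) = p_symbol_class p a b f \<otimes>\<^bsub>p_symbol p a b\<^esub> p_symbol_class p a b g"
  "p_symbol_class p a b (f + g) = p_symbol_class p a b f \<oplus>\<^bsub>p_symbol p a b\<^esub> p_symbol_class p a b g"
  "p_symbol_class p a b 1 = \<one>\<^bsub>p_symbol p a b\<^esub>"
  using p_symbol_class_hom[of p a b] by (auto simp: ring_hom_def)

lemma p_symbol_smult:
  "c \<odot>\<^bsub>p_symbol p a b\<^esub> p_symbol_class p a b f = p_symbol_class p a b (scalar c * f)"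
  unfolding p_symbol_class_simps(2)
  by (simp add: p_symbol_def presented_algebra_def Let_def p_symbol_class_def)

lemma p_symbol_class_power:
  "p_symbol_class p a b (f ^ n) = p_symbol_class p a b f [^]\<^bsub>p_symbol p a b\<^esub> n"
proof -
  interpret ring "p_symbol p a b" by (rule ring_p_symbol)
  show ?thesis
    by (induction n) (simp_all add: p_symbol_class_simps power_Suc2 del: power_Suc)
qed

lemma p_symbol_class_eqI:
  fixes a b :: "'f::field" and p :: nat
  assumes "f - g \<in> p_symbol_relators p a b"
  shows "p_symbol_class p a b f = p_symbol_class p a b g"
proof -
  interpret R: ring "free_algebra :: ('f, (xy, 'f) free_alg) module" by (rule ring_free_algebra)
  let ?I = "genideal free_algebra (p_symbol_relators p a b)"
  interpret ideal ?I free_algebra by (rule ideal_p_symbol_relators)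
  have neg: "\<ominus>\<^bsub>free_algebra\<^esub> h = - h" for h :: "(xy, 'f) free_alg"
    by (rule R.minus_equality) simp_all
  have "p_symbol_relators p a b \<subseteq> ?I"
    by (rule R.genideal_self) simp
  then have "f \<ominus>\<^bsub>free_algebra\<^esub> g \<in> ?I"
    using assms by (auto simp: a_minus_def neg)
  then show ?thesis
    unfolding p_symbol_class_def
    by (subst R.quotient_eq_iff_same_a_r_cos[OF ideal_p_symbol_relators, symmetric]) simp_all
qed

lemma p_symbol_relations:
  fixes a b :: "'f::field" and p :: nat
  assumes "p > 0" "b \<noteq> 0"
  defines "A \<equiv> p_symbol p a b"
  defines "x \<equiv> p_symbol_class p a b (gen GenX)" and "y \<equiv> p_symbol_class p a b (gen GenY)"
  shows "x [^]\<^bsub>A\<^esub> p \<ominus>\<^bsub>A\<^esub> x = a \<odot>\<^bsub>A\<^esub> \<one>\<^bsub>A\<^esub>"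
    and "y [^]\<^bsub>A\<^esub> p = b \<odot>\<^bsub>A\<^esub> \<one>\<^bsub>A\<^esub>"
    and "y \<in> Units A"
    and "y \<otimes>\<^bsub>A\<^esub> x \<otimes>\<^bsub>A\<^esub> inv\<^bsub>A\<^esub> y = x \<oplus>\<^bsub>A\<^esub> \<one>\<^bsub>A\<^esub>"
proof -
  interpret A: ring A unfolding A_def by (rule ring_p_symbol)
  let ?c = "p_symbol_class p a b"
  note cs = p_symbol_class_simps[of p a b, folded A_def]
  note cp = p_symbol_class_power[of p a b, folded A_def]
  have sm: "d \<odot>\<^bsub>A\<^esub> \<one>\<^bsub>A\<^esub> = ?c (scalar d)" for d
    using p_symbol_smult[where c = d and p = p and a = a and b = b and f = 1] by (simp add: A_def p_symbol_class_simps(4))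
  have carr [simp]: "x \<in> carrier A" "y \<in> carrier A" by (simp_all add: x_def y_def cs)
  have "?c (gen GenX ^ p) = ?c (scalar a + gen GenX)"
    by (rule p_symbol_class_eqI) (simp add: p_symbol_relators_def algebra_simps)
  then have "x [^]\<^bsub>A\<^esub> p = ?c (scalar a) \<oplus>\<^bsub>A\<^esub> x"
    by (simp add: cs cp x_def)
  then show "x [^]\<^bsub>A\<^esub> p \<ominus>\<^bsub>A\<^esub> x = a \<odot>\<^bsub>A\<^esub> \<one>\<^bsub>A\<^esub>"
    unfolding sm by (simp add: a_minus_def A.a_assoc A.r_neg cs)
  have yb: "?c (gen GenY ^ p) = ?c (scalar b)"
    by (rule p_symbol_class_eqI) (simp add: p_symbol_relators_def)
  then show "y [^]\<^bsub>A\<^esub> p = b \<odot>\<^bsub>A\<^esub> \<one>\<^bsub>A\<^esub>"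
    by (simp add: sm cp y_def)
  have sc: "scalar (1 / b) * scalar b = (1 :: (xy, 'f) free_alg)"
    "scalar b * scalar (1 / b) = (1 :: (xy, 'f) free_alg)"
    using assms(2) by (simp_all add: scalar_def mult_single)
  have comm: "gen GenY * scalar (1 / b) = (scalar (1 / b) * gen GenY :: (xy, 'f) free_alg)"
    by (simp add: scalar_def gen_def mult_single)
  let ?z = "scalar (1 / b) * gen GenY ^ (p - 1) :: (xy, 'f) free_alg"
  have pw: "gen GenY * gen GenY ^ (p - 1) = (gen GenY ^ p :: (xy, 'f) free_alg)"
    "gen GenY ^ (p - 1) * gen GenY = (gen GenY ^ p :: (xy, 'f) free_alg)"
    using assms(1) by (cases p; simp add: power_commutes)+
  have one: "?c (scalar (1 / b) * gen GenY ^ p) = \<one>\<^bsub>A\<^esub>"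
    using yb by (metis cs(2) cs(4) sc(1))
  have zy: "?c ?z \<otimes>\<^bsub>A\<^esub> y = \<one>\<^bsub>A\<^esub>"
    using one by (simp only: y_def cs(2)[symmetric] mult.assoc pw)
  have "gen GenY * ?z = scalar (1 / b) * gen GenY ^ p"
    by (simp only: mult.assoc[symmetric] comm) (simp only: mult.assoc pw)
  then have yz: "y \<otimes>\<^bsub>A\<^esub> ?c ?z = \<one>\<^bsub>A\<^esub>"
    using one by (simp only: y_def cs(2)[symmetric])
  show U: "y \<in> Units A"
    using zy yz cs(1)[of ?z] unfolding Units_def by auto
  have "?c (gen GenY * gen GenX) = ?c ((gen GenX + 1) * gen GenY)"
    by (rule p_symbol_class_eqI) (simp add: p_symbol_relators_def)
  then have "y \<otimes>\<^bsub>A\<^esub> x = (x \<oplus>\<^bsub>A\<^esub> \<one>\<^bsub>A\<^esub>) \<otimes>\<^bsub>A\<^esub> y"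
    by (simp only: cs x_def y_def)
  then show "y \<otimes>\<^bsub>A\<^esub> x \<otimes>\<^bsub>A\<^esub> inv\<^bsub>A\<^esub> y = x \<oplus>\<^bsub>A\<^esub> \<one>\<^bsub>A\<^esub>"
    using U by (simp add: A.m_assoc)
qed


subsection \<open>The two fields\<close>

text \<open>
  With \<open>'k\<close> a field of \<open>p\<close> elements: the field of fractions of
  \<open>'k[\<alpha>][\<beta>]\<close>, and \<open>'k((\<alpha>))((\<beta>))\<close>, the Laurent series in \<open>\<beta>\<close>
  with coefficients in \<open>'k((\<alpha>))\<close>.
\<close>

type_synonym 'k ratfun2 = "'k poly poly fract"

definition alpha_rat :: "'k::field ratfun2" where
  "alpha_rat = to_fract [:[:0, 1:]:]"

definition beta_rat :: "'k::field ratfun2" where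
  "beta_rat = to_fract [:0, 1:]"

type_synonym 'k laurent2 = "'k fls fls"

definition alpha_laurent :: "'k::field laurent2" where
  "alpha_laurent = fls_const fls_X"

definition beta_laurent :: "'k::field laurent2" where
  "beta_laurent = fls_X"

end

theory Submission
  imports Defs "HOL-Algebra.Algebraic_Closure_Type" "HOL-Library.Product_Lexorder" "HOL-Library.Product_Plus"
begin

text \<open>
  Let \<open>E = K((s))((t))\<close>, where \<open>K\<close> is an algebraic closure of the field \<open>k\<close> with \<open>p\<close>
  elements, and let \<open>\<kappa>\<close> embed either of the two fields \<open>F\<close> into \<open>E\<close> by \<open>\<alpha> \<mapsto> s\<close> and
  \<open>\<beta> \<mapsto> t\<close>. Let a scalar \<open>r\<close> of \<open>F\<close> act on \<open>E\<close> as multiplication by \<open>\<kappa>(r)\<^sup>p\<close>. With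
  \<open>\<xi>\<^sup>p - \<xi> = 1\<close> in \<open>K\<close> and the Euler derivations \<open>\<theta>\<^sub>s = s d/ds\<close>, \<open>\<theta>\<^sub>t = t d/dt\<close>, the
  algebra \<open>[1,\<alpha>)\<close> acts on \<open>E\<close> by \<open>x \<mapsto> \<xi> - \<theta>\<^sub>s\<close> and \<open>y \<mapsto> s\<close>, and \<open>[1,\<beta>)\<close> acts by
  \<open>x \<mapsto> \<xi> - \<theta>\<^sub>t\<close> and \<open>y \<mapsto> t\<close>. The relation \<open>x\<^sup>p - x = 1\<close> holds because \<open>\<theta>\<^sup>p = \<theta>\<close> in
  characteristic \<open>p\<close>.

  Order \<open>E\<close> by its lexicographic valuation with values in \<open>\<int>\<^sup>2\<close>. On the eigenspace of \<open>\<theta>\<^sub>s\<close> with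
  eigenvalue \<open>l\<close>, an operator \<open>z\<close> coming from \<open>[1,\<alpha>)\<close> is multiplication by a series \<open>u\<^sub>l\<close>, and the
  coefficientwise Frobenius map permutes the \<open>u\<^sub>l\<close> cyclically, as conjugation by \<open>y\<close> does; so all
  of them have the same value. Eigenvectors for different eigenvalues have different values, so
  leading terms cannot cancel, and every nonzero \<open>z\<close> raises all values by the constant
  \<open>v(u\<^sub>0)\<close> (\<open>homogeneous_shift\<close>). Since \<open>\<theta>\<^sub>t\<close> kills the image of the scalars and \<open>s\<close>, it kills
  \<open>u\<^sub>0\<close>; hence the \<open>t\<close>-component of that constant is divisible by \<open>p\<close>. For \<open>[1,\<beta>)\<close> the
  roles of \<open>s\<close> and \<open>t\<close> are exchanged.

  Suppose now that both algebras have the form \<open>[_,b)\<close>. The second generator of \<open>[_,b)\<close> gives an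
  operator \<open>z\<close> with \<open>z\<^sup>p = \<kappa>(b)\<^sup>p\<close>. Subtract from \<open>\<kappa>(b)\<close> all its terms whose exponents are both
  divisible by \<open>p\<close>; they form a \<open>p\<close>-th power \<open>c\<^sup>p\<close> (\<open>subtract_pth_power\<close>). The central
  operator \<open>c\<^sup>p\<close> may be subtracted from \<open>z\<close>, and \<open>(z - c\<^sup>p)\<^sup>p = (\<kappa>(b) - c\<^sup>p)\<^sup>p\<close>. If this
  vanishes, then \<open>z = c\<^sup>p\<close> is central, contrary to \<open>zx = (x + 1)z\<close>. Otherwise \<open>z - c\<^sup>p\<close> raises values by
  exactly \<open>v(\<kappa>(b) - c\<^sup>p)\<close> (\<open>value_of_pth_root\<close>). So \<open>p\<close> divides one component of this value
  because of \<open>[1,\<alpha>)\<close> and the other because of \<open>[1,\<beta>)\<close>, although it is the exponent of a term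
  that has survived the subtraction.
\<close>

hide_const (open) Divisibility.prime

section \<open>Additive endomorphisms\<close>

text \<open>
  A type of its own gives additive maps the class of rings, hence powers and a characteristic. Fields
  are nonzero, so the ring is nontrivial.
\<close>
typedef (overloaded) 'm endo = "{f :: 'm::field \<Rightarrow> 'm. \<forall>x y. f (x + y) = f x + f y}"
  morphisms app Endo
  by (rule exI[of _ "\<lambda>x. x"]) simp

setup_lifting type_definition_endo

instantiation endo :: (field) ring_1
begin
lift_definition zero_endo :: "'a endo" is "\<lambda>_. 0" by simp
lift_definition one_endo :: "'a endo" is "\<lambda>x. x" by simp
lift_definition plus_endo :: "'a endo \<Rightarrow> 'a endo \<Rightarrow> 'a endo" is "\<lambda>f g x. f x + g x" by simp
lift_definition minus_endo :: "'a endo \<Rightarrow> 'a endo \<Rightarrow> 'a endo" is "\<lambda>f g x. f x - g x" by simp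
lift_definition uminus_endo :: "'a endo \<Rightarrow> 'a endo" is "\<lambda>f x. - f x" by simp
lift_definition times_endo :: "'a endo \<Rightarrow> 'a endo \<Rightarrow> 'a endo" is "\<lambda>f g x. f (g x)" by simp
instance
proof
  show "(0 :: 'a endo) \<noteq> 1"
    by transfer (metis zero_neq_one)
qed (transfer; simp add: fun_eq_iff algebra_simps)+
end

lift_definition mult_op :: "'a::field \<Rightarrow> 'a endo" is "\<lambda>a x. a * x"
  by (simp add: distrib_left)

lemma endo_eqI: "(\<And>m. app z m = app z' m) \<Longrightarrow> z = z'"
  by (metis app_inject ext)

lemma app_simps [simp]:
  "app 0 m = 0" "app 1 m = m" "app (z + z') m = app z m + app z' m"
  "app (z - z') m = app z m - app z' m" "app (z * z') m = app z (app z' m)"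
  "app (mult_op a) m = a * m" "app z (m + m') = app z m + app z m'"
  by (transfer; simp)+

lemma app_0 [simp]: "app z 0 = 0"
  by (metis add_0 add_cancel_right_right app_simps(7))

lemma app_sum: "app z (sum f A) = (\<Sum>i\<in>A. app z (f i))"
  by (induction A rule: infinite_finite_induct) simp_all

lemma mult_op_add: "mult_op (a + b) = mult_op a + mult_op b"
  and mult_op_diff: "mult_op (a - b) = mult_op a - mult_op b"
  and mult_op_mult: "mult_op (a * b) = mult_op a * mult_op b"
  and mult_op_0 [simp]: "mult_op 0 = 0"
  and mult_op_1 [simp]: "mult_op 1 = 1"
  by (rule endo_eqI; simp add: algebra_simps)+

lemma mult_op_power: "mult_op (a ^ n) = mult_op a ^ n"
  by (induction n) (simp_all add: mult_op_mult)

lemma mult_op_of_nat: "mult_op (of_nat n) = of_nat n"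
  by (induction n) (simp_all add: mult_op_add)

lemma mult_op_eq_iff: "mult_op a = mult_op b \<longleftrightarrow> a = b"
  by (metis app_simps(6) mult.right_neutral)


lemma commuting_binomial:
  fixes x y :: "'r::ring_1"
  assumes xy: "x * y = y * x"
  shows "(x + y) ^ n = (\<Sum>k\<le>n. of_nat (n choose k) * (x ^ k * y ^ (n - k)))"
proof (induction n)
  case (Suc n)
  have of_nat_left: "a * (of_nat m * b) = of_nat m * (a * b)" for a b :: 'r and m
    by (simp only: mult.assoc[symmetric] mult_of_nat_commute[of m a])
  have yx: "y * x ^ k = x ^ k * y" for k
    by (rule power_commuting_commutes[symmetric]) (rule xy)
  have "(x + y) ^ Suc n = (x + y) * (\<Sum>k\<le>n. of_nat (n choose k) * (x ^ k * y ^ (n - k)))"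
    by (simp add: Suc)
  also have "\<dots> = (\<Sum>k\<le>n. of_nat (n choose k) * (x ^ Suc k * y ^ (n - k))) +
      (\<Sum>k\<le>n. of_nat (n choose k) * (x ^ k * y ^ (Suc n - k)))"
  proof -
    have 1: "x * (of_nat (n choose k) * (x ^ k * y ^ (n - k)))
        = of_nat (n choose k) * (x ^ Suc k * y ^ (n - k))" for k
      by (simp add: of_nat_left mult.assoc)
    have 2: "y * (of_nat (n choose k) * (x ^ k * y ^ (n - k)))
        = of_nat (n choose k) * (x ^ k * y ^ (Suc n - k))" if "k \<le> n" for k
    proof -
      have "y * (of_nat (n choose k) * (x ^ k * y ^ (n - k)))
          = of_nat (n choose k) * (y * x ^ k * y ^ (n - k))"
        by (simp add: of_nat_left mult.assoc)
      then show ?thesis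
        using that by (simp add: yx mult.assoc Suc_diff_le)
    qed
    have "x * (\<Sum>k\<le>n. of_nat (n choose k) * (x ^ k * y ^ (n - k)))
        = (\<Sum>k\<le>n. of_nat (n choose k) * (x ^ Suc k * y ^ (n - k)))"
      unfolding sum_distrib_left by (rule sum.cong) (simp_all only: 1)
    moreover have "y * (\<Sum>k\<le>n. of_nat (n choose k) * (x ^ k * y ^ (n - k)))
        = (\<Sum>k\<le>n. of_nat (n choose k) * (x ^ k * y ^ (Suc n - k)))"
      unfolding sum_distrib_left by (rule sum.cong) (simp_all only: 2 atMost_iff)
    ultimately show ?thesis
      by (simp only: distrib_right)
  qed
  also have "(\<Sum>k\<le>n. of_nat (n choose k) * (x ^ k * y ^ (Suc n - k)))
      = (\<Sum>k\<le>Suc n. of_nat (n choose k) * (x ^ k * y ^ (Suc n - k)))"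
    by (simp add: binomial_eq_0)
  also have "\<dots> = y ^ Suc n + (\<Sum>k\<le>n. of_nat (n choose Suc k) * (x ^ Suc k * y ^ (n - k)))"
    by (subst sum.atMost_Suc_shift) simp
  also have "(\<Sum>k\<le>n. of_nat (n choose k) * (x ^ Suc k * y ^ (n - k))) +
      (y ^ Suc n + (\<Sum>k\<le>n. of_nat (n choose Suc k) * (x ^ Suc k * y ^ (n - k))))
      = y ^ Suc n + (\<Sum>k\<le>n. of_nat (Suc n choose Suc k) * (x ^ Suc k * y ^ (n - k)))"
    by (simp add: sum.distrib distrib_right del: power_Suc)
  also have "\<dots> = (\<Sum>k\<le>Suc n. of_nat (Suc n choose k) * (x ^ k * y ^ (Suc n - k)))"
    by (subst sum.atMost_Suc_shift) (simp del: binomial_Suc_Suc power_Suc)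
  finally show ?case .
qed simp

text \<open>
  The summands will be an operator and a central multiplication inside a noncommutative ring, which
  is why commutativity is asked of the two elements only.
\<close>
lemma commuting_freshmans_dream:
  fixes x y :: "'r::ring_1"
  assumes "x * y = y * x" "prime p" "of_nat p = (0 :: 'r)"
  shows "(x + y) ^ p = x ^ p + y ^ p"
proof -
  have p: "p > 0" using assms(2) by (simp add: prime_gt_0_nat)
  have "(x + y) ^ p = (\<Sum>k\<le>p. of_nat (p choose k) * (x ^ k * y ^ (p - k)))"
    by (rule commuting_binomial) (rule assms)
  also have "\<dots> = (\<Sum>k\<in>{0,p}. of_nat (p choose k) * (x ^ k * y ^ (p - k)))"
  proof (intro sum.mono_neutral_right ballI)
    fix k assume "k \<in> {..p} - {0, p}"
    then have "p dvd (p choose k)"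
      using assms(2) by (intro dvd_choose_prime) auto
    then obtain q where "p choose k = p * q" ..
    then show "of_nat (p choose k) * (x ^ k * y ^ (p - k)) = 0"
      by (simp add: assms(3))
  qed auto
  finally show ?thesis
    using p by (simp add: add_ac)
qed

section \<open>Homomorphisms out of presented algebras\<close>

definition free_eval ::
  "('f::comm_ring_1 \<Rightarrow> 'r::ring_1) \<Rightarrow> ('g \<Rightarrow> 'r) \<Rightarrow> ('g, 'f) free_alg \<Rightarrow> 'r" where
  "free_eval c g f = (\<Sum>w\<in>Poly_Mapping.keys f. c (Poly_Mapping.lookup f w) * prod_list (map g (letters w)))"

locale free_eval_hom =
  fixes c :: "'f::comm_ring_1 \<Rightarrow> 'r::ring_1" and g :: "'g \<Rightarrow> 'r"
  assumes c_add: "c (a + b) = c a + c b"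
    and c_mult: "c (a * b) = c a * c b"
    and c_1: "c 1 = 1"
    and c_comm: "c a * g l = g l * c a"
begin

abbreviation "ev \<equiv> free_eval c g"

lemma c_0: "c 0 = 0"
  using c_add[of 0 0] by simp

lemma c_comm_word: "c a * prod_list (map g w) = prod_list (map g w) * c a"
  by (induction w) (simp_all, metis c_comm mult.assoc)

lemma ev_eq: "finite A \<Longrightarrow> Poly_Mapping.keys f \<subseteq> A \<Longrightarrow>
    ev f = (\<Sum>w\<in>A. c (Poly_Mapping.lookup f w) * prod_list (map g (letters w)))"
  unfolding free_eval_def
  by (rule sum.mono_neutral_left) (auto simp: c_0 in_keys_iff)

lemma ev_add: "ev (f + h) = ev f + ev h"
proof -
  let ?A = "Poly_Mapping.keys f \<union> Poly_Mapping.keys h"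
  have "Poly_Mapping.keys (f + h) \<subseteq> ?A" by (rule keys_add)
  then show ?thesis
    by (simp add: ev_eq[of ?A] lookup_add c_add distrib_right sum.distrib)
qed

lemma ev_0: "ev 0 = 0"
  by (simp add: free_eval_def)

lemma ev_diff: "ev (f - h) = ev f - ev h"
  using ev_add[of "f - h" h] by simp

lemma ev_single: "ev (Poly_Mapping.single w a) = c a * prod_list (map g (letters w))"
  by (simp add: free_eval_def c_0)

lemma update_as_sum:
  "a \<notin> Poly_Mapping.keys f \<Longrightarrow> Poly_Mapping.update a b f = f + Poly_Mapping.single a b"
  by (rule poly_mapping_eqI) (auto simp: lookup_update lookup_add lookup_single in_keys_iff)

lemma ev_mult: "ev (f * h) = ev f * ev h"
proof (induction f rule: Poly_Mapping.update_induct)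
  case (update f a b)
  have "ev (Poly_Mapping.single a b * h) = ev (Poly_Mapping.single a b) * ev h"
  proof (induction h rule: Poly_Mapping.update_induct)
    case (update h a' b')
    have "ev (Poly_Mapping.single a b * Poly_Mapping.single a' b')
        = ev (Poly_Mapping.single a b) * ev (Poly_Mapping.single a' b')"
      by (simp add: mult_single ev_single plus_free_monoid_def c_mult)
        (metis c_comm_word mult.assoc)
    with update show ?case
      by (simp add: update_as_sum ev_add distrib_left)
  qed (simp add: ev_0)
  with update show ?case
    by (simp add: update_as_sum ev_add distrib_right)
qed (simp add: ev_0)

lemma ev_scalar: "ev (scalar a) = c a"
  by (simp add: scalar_def ev_single zero_free_monoid_def)

lemma ev_1: "ev 1 = 1"
  using ev_scalar[of 1] by (simp add: scalar_def c_1)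

lemma ev_gen: "ev (gen l) = g l"
  by (simp add: gen_def ev_single c_1)

lemma ev_power: "ev (f ^ n) = ev f ^ n"
  by (induction n) (simp_all add: ev_1 ev_mult)

lemma kernel_ideal: "ideal {f. ev f = 0} free_algebra"
proof (rule idealI)
  interpret R: ring "free_algebra :: ('f, ('g, 'f) free_alg) module" by (rule ring_free_algebra)
  show "ring (free_algebra :: ('f, ('g, 'f) free_alg) module)" by (rule R.ring_axioms)
  show "subgroup {f. ev f = 0} (add_monoid free_algebra)"
  proof (rule group.subgroupI[OF R.a_group])
    fix f assume f: "f \<in> {f. ev f = 0}"
    have "inv\<^bsub>add_monoid free_algebra\<^esub> f = - f"
      by (rule group.inv_equality[OF R.a_group]) simp_all
    then show "inv\<^bsub>add_monoid free_algebra\<^esub> f \<in> {f. ev f = 0}"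
      using f ev_diff[of 0 f] by (simp add: ev_0)
  qed (auto simp: ev_add intro: exI[of _ 0] ev_0)
qed (auto simp: ev_mult)

text \<open>
  The kernel of an evaluation is a two-sided ideal, so it contains the ideal generated by the
  relators as soon as it contains the relators. This replaces an induced map on the quotient: it is
  enough to evaluate representatives.
\<close>
lemma ev_eq_of_ideal:
  assumes "\<And>r. r \<in> S \<Longrightarrow> ev r = 0"
    and "genideal free_algebra S +>\<^bsub>free_algebra\<^esub> f = genideal free_algebra S +>\<^bsub>free_algebra\<^esub> h"
  shows "ev f = ev h"
proof -
  interpret R: ring "free_algebra :: ('f, ('g, 'f) free_alg) module" by (rule ring_free_algebra)
  have neg: "\<ominus>\<^bsub>free_algebra\<^esub> h = - h" for h :: "('g, 'f) free_alg"
    by (rule R.minus_equality) simp_all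
  have "genideal free_algebra S \<subseteq> {f. ev f = 0}"
    by (rule R.genideal_minimal[OF kernel_ideal]) (use assms(1) in auto)
  moreover have "f \<ominus>\<^bsub>free_algebra\<^esub> h \<in> genideal free_algebra S"
    using R.quotient_eq_iff_same_a_r_cos[of "genideal free_algebra S" f h] assms(2)
      R.genideal_ideal[of S] by simp
  ultimately show ?thesis
    by (auto simp: a_minus_def neg ev_diff)
qed

end

text \<open>
  Representatives of the generators of \<open>[a,b)\<close>, transported along the isomorphism, evaluate to
  elements satisfying the two relations that involve the second slot \<open>b\<close>, the slot that linkage
  shares.
\<close>
lemma p_symbol_iso_image:
  fixes c :: "'f::field \<Rightarrow> 'r::ring_1"
  assumes hom: "free_eval_hom c g"
    and rels: "g GenX ^ p = g GenX + c a0" "g GenY ^ p = c b0" "g GenY * g GenX = (g GenX + 1) * g GenY"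
    and iso: "algebra_iso (p_symbol p a0 b0) (p_symbol p a b)"
    and p: "p > 0" and b: "b \<noteq> 0"
  shows "\<exists>x y. x \<in> range (free_eval c g) \<and> y \<in> range (free_eval c g) \<and>
      y ^ p = c b \<and> y * x = (x + 1) * y"
proof -
  interpret free_eval_hom c g by (rule hom)
  let ?A = "p_symbol p a0 b0" and ?B = "p_symbol p a b"
  interpret A: ring ?A by (rule ring_p_symbol)
  interpret B: ring ?B by (rule ring_p_symbol)
  let ?cl = "p_symbol_class p a0 b0" and ?cB = "p_symbol_class p a b"
  obtain h where h: "h \<in> ring_iso ?A ?B" and hs: "\<And>c v. v \<in> carrier ?A \<Longrightarrow> h (c \<odot>\<^bsub>?A\<^esub> v) = c \<odot>\<^bsub>?B\<^esub> h v"
    using iso unfolding algebra_iso_def by blast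
  have hom_h: "h \<in> ring_hom ?A ?B" and bij: "bij_betw h (carrier ?A) (carrier ?B)"
    using h by (auto simp: ring_iso_def)
  have surj_class: "\<exists>f. v = ?cl f" if "v \<in> carrier ?A" for v
    using that by (auto simp: p_symbol_simps FactRing_def A_RCOSETS_def' p_symbol_class_def)
  have lift: "\<exists>f. h (?cl f) = v" if v: "v \<in> carrier ?B" for v
  proof -
    from v have "v \<in> h ` carrier ?A"
      unfolding bij_betw_imp_surj_on[OF bij] .
    then obtain u where u: "u \<in> carrier ?A" "v = h u" ..
    obtain f where "u = ?cl f" using surj_class[OF u(1)] ..
    with u(2) have "h (?cl f) = v" by (simp only:)
    then show ?thesis ..
  qed
  have ev_cl: "ev f = ev f'" if "h (?cl f) = h (?cl f')" for f f'
  proof -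
    have "?cl f = ?cl f'"
      using that bij p_symbol_class_simps(1) by (metis bij_betw_imp_inj_on inj_onD)
    moreover have "ev r = 0" if "r \<in> p_symbol_relators p a0 b0" for r
      using that rels
      by (auto simp: p_symbol_relators_def ev_diff ev_add ev_mult ev_power ev_gen ev_scalar ev_1)
    ultimately show ?thesis
      unfolding p_symbol_class_def by (intro ev_eq_of_ideal)
  qed
  obtain f where f: "h (?cl f) = ?cB (gen GenX)"
    using lift[OF p_symbol_class_simps(1)] by blast
  obtain k where k: "h (?cl k) = ?cB (gen GenY)"
    using lift[OF p_symbol_class_simps(1)] by blast
  note hsimps = ring_hom_add[OF hom_h] ring_hom_mult[OF hom_h] ring_hom_one[OF hom_h]
  note cl = p_symbol_class_simps
  have hpow: "h (?cl (k ^ n)) = ?cB (gen GenY ^ n)" for n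
    by (induction n) (simp_all add: hsimps cl k)
  have hscal: "h (?cl (scalar b)) = ?cB (scalar b)"
    using hs[of "?cl 1" b] by (simp add: p_symbol_smult cl hsimps p_symbol_smult[where f = 1, simplified cl, simplified])
  have "ev (k ^ p) = ev (scalar b)"
  proof (rule ev_cl)
    have "?cB (gen GenY ^ p) = ?cB (scalar b)"
      by (rule p_symbol_class_eqI) (simp add: p_symbol_relators_def)
    then show "h (?cl (k ^ p)) = h (?cl (scalar b))"
      by (simp add: hpow hscal)
  qed
  moreover have "ev (k * f) = ev ((f + 1) * k)"
  proof (rule ev_cl)
    have "?cB (gen GenY * gen GenX) = ?cB ((gen GenX + 1) * gen GenY)"
      by (rule p_symbol_class_eqI) (simp add: p_symbol_relators_def)
    then show "h (?cl (k * f)) = h (?cl ((f + 1) * k))"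
      by (simp add: hsimps cl f k)
  qed
  ultimately show ?thesis
    by (intro exI[of _ "ev f"] exI[of _ "ev k"])
      (auto simp: ev_power ev_mult ev_add ev_1 ev_scalar)
qed

section \<open>Operators built from a derivation and a cyclic twist\<close>

lemma CHAR_eq_prime:
  assumes "prime p" "of_nat p = (0 :: 'r::comm_ring_1)"
  shows "CHAR('r) = p"
proof -
  have "CHAR('r) dvd p" using assms(2) by (simp add: of_nat_eq_0_iff_char_dvd)
  moreover have "CHAR('r) \<noteq> 1"
    by (metis of_nat_1 of_nat_CHAR zero_neq_one)
  ultimately show ?thesis using assms(1) by (auto simp: prime_nat_iff)
qed

lemma of_int_power_prime_char:
  fixes n :: int
  assumes "prime p" "of_nat p = (0 :: 'r::comm_ring_1)"
  shows "(of_int n :: 'r) ^ p = of_int n"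
proof -
  have p: "p > 0" using assms(1) by (simp add: prime_gt_0_nat)
  have char: "CHAR('r) = p" by (rule CHAR_eq_prime) fact+
  have nat: "(of_nat k :: 'r) ^ p = of_nat k" for k
  proof (induction k)
    case (Suc k)
    have "(1 + of_nat k :: 'r) ^ p = 1 ^ p + of_nat k ^ p"
      by (rule freshmans_dream) (simp_all add: char assms(1))
    with Suc show ?case by simp
  qed (use p in \<open>simp add: zero_power\<close>)
  have "(of_int n :: 'r) = of_nat (nat (n mod int p))"
  proof -
    have "n = int p * (n div int p) + int (nat (n mod int p))"
      using p by simp
    then have "(of_int n :: 'r) = of_nat p * of_int (n div int p) + of_nat (nat (n mod int p))"
      by (metis of_int_add of_int_mult of_int_of_nat_eq)
    then show ?thesis by (simp add: assms(2))
  qed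
  then show ?thesis by (simp add: nat)
qed

text \<open>
  The action of a symbol algebra \<open>[1,y\<^sup>p)\<close> on a field, with \<open>x\<close> acting as \<open>\<xi> - \<theta>\<close>. The map \<open>\<phi>\<close>
  stands for the Frobenius on coefficients: it moves \<open>\<xi>\<close> to \<open>\<xi> + 1\<close>, as conjugation by \<open>y\<close> moves
  \<open>x\<close> to \<open>x + 1\<close>. The second derivation \<open>\<theta>'\<close> records in which variable the operators only have
  exponents divisible by \<open>p\<close>, and \<open>d\<close> picks the component of the value \<open>v\<close> from which the
  eigenvalue of \<open>\<theta>\<close> can be read off.
\<close>
locale twisted_derivation =
  fixes p :: nat
    and \<theta> \<theta>' \<phi> :: "'e::field \<Rightarrow> 'e"
    and \<xi> y :: 'e
    and v :: "'e \<Rightarrow> int \<times> int"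
    and d :: "int \<times> int \<Rightarrow> int"
  assumes prime_p: "prime p" and char_p: "of_nat p = (0 :: 'e)"
    and \<theta>_add: "\<theta> (a + b) = \<theta> a + \<theta> b" and \<theta>_mult: "\<theta> (a * b) = \<theta> a * b + a * \<theta> b"
    and \<theta>'_add: "\<theta>' (a + b) = \<theta>' a + \<theta>' b" and \<theta>'_mult: "\<theta>' (a * b) = \<theta>' a * b + a * \<theta>' b"
    and \<theta>_\<theta>': "\<theta>' (\<theta> a) = \<theta> (\<theta>' a)"
    and \<phi>_add: "\<phi> (a + b) = \<phi> a + \<phi> b" and \<phi>_mult: "\<phi> (a * b) = \<phi> a * \<phi> b"
    and \<phi>_1: "\<phi> 1 = 1" and \<phi>_\<theta>: "\<phi> (\<theta> a) = \<theta> (\<phi> a)"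
    and \<xi>: "\<xi> ^ p = \<xi> + 1" "\<phi> \<xi> = \<xi> + 1" "\<theta> \<xi> = 0" "\<theta>' \<xi> = 0"
    and y: "\<theta> y = y" "\<theta>' y = 0" "\<phi> y = y"
    and eigen_decomp: "\<exists>M. m = (\<Sum>i<p. M i) \<and> (\<forall>i<p. \<theta> (M i) = of_nat i * M i)"
    and v_mult: "a \<noteq> 0 \<Longrightarrow> b \<noteq> 0 \<Longrightarrow> v (a * b) = v a + v b"
    and v_add: "a \<noteq> 0 \<Longrightarrow> b \<noteq> 0 \<Longrightarrow> v a < v b \<Longrightarrow> a + b \<noteq> 0 \<and> v (a + b) = v a"
    and v_\<phi>: "v (\<phi> a) = v a"
    and v_eigen: "m \<noteq> 0 \<Longrightarrow> \<theta> m = of_nat i * m \<Longrightarrow> i < p \<Longrightarrow> d (v m) mod int p = int i"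
begin

lemma p_pos: "p > 0"
  using prime_p by (simp add: prime_gt_0_nat)

lemma \<theta>_0: "\<theta> 0 = 0" and \<theta>'_0: "\<theta>' 0 = 0" and \<phi>_0: "\<phi> 0 = 0"
  by (metis \<theta>_add \<theta>'_add \<phi>_add add_0 add_cancel_right_right)+

lemma \<theta>_minus: "\<theta> (- a) = - \<theta> a" and \<theta>'_minus: "\<theta>' (- a) = - \<theta>' a" and \<phi>_minus: "\<phi> (- a) = - \<phi> a"
  using \<theta>_add[of a "-a"] \<theta>'_add[of a "-a"] \<phi>_add[of a "-a"]
  by (simp_all add: \<theta>_0 \<theta>'_0 \<phi>_0 eq_neg_iff_add_eq_0 add.commute)

lemma \<theta>_diff: "\<theta> (a - b) = \<theta> a - \<theta> b" and \<theta>'_diff: "\<theta>' (a - b) = \<theta>' a - \<theta>' b"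
  and \<phi>_diff: "\<phi> (a - b) = \<phi> a - \<phi> b"
  using \<theta>_add[of a "-b"] \<theta>'_add[of a "-b"] \<phi>_add[of a "-b"] by (simp_all add: \<theta>_minus \<theta>'_minus \<phi>_minus)

lemma \<theta>_of_int: "\<theta> (of_int n) = 0" and \<theta>'_of_int: "\<theta>' (of_int n) = 0"
  and \<phi>_of_int: "\<phi> (of_int n) = of_int n"
proof -
  have "\<theta> 1 = 0" "\<theta>' 1 = 0"
    by (rule add_cancel_right_right[THEN iffD1, OF \<theta>_mult[of 1 1, unfolded mult_1 mult_1_right]]
        add_cancel_right_right[THEN iffD1, OF \<theta>'_mult[of 1 1, unfolded mult_1 mult_1_right]])+
  then have "\<theta> (of_nat k) = 0 \<and> \<theta>' (of_nat k) = 0 \<and> \<phi> (of_nat k) = of_nat k" for k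
    by (induction k) (simp_all add: \<theta>_0 \<theta>'_0 \<phi>_0 \<theta>_add \<theta>'_add \<phi>_add \<phi>_1)
  moreover obtain i j where "n = int i - int j"
    by (rule int_diff_cases)
  ultimately show "\<theta> (of_int n) = 0" "\<theta>' (of_int n) = 0" "\<phi> (of_int n) = of_int n"
    by (simp_all add: \<theta>_diff \<theta>'_diff \<phi>_diff)
qed

lemma \<phi>_power: "\<phi> (a ^ n) = \<phi> a ^ n"
  by (induction n) (simp_all add: \<phi>_1 \<phi>_mult)

lemma \<theta>_power_p: "\<theta> (a ^ p) = 0" and \<theta>'_power_p: "\<theta>' (a ^ p) = 0"
proof -
  have "\<theta> (a ^ n) = of_nat n * a ^ (n - 1) * \<theta> a \<and> \<theta>' (a ^ n) = of_nat n * a ^ (n - 1) * \<theta>' a" for n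
  proof (induction n)
    case 0
    then show ?case using \<theta>_of_int[of 1] \<theta>'_of_int[of 1] by simp
  next
    case (Suc n)
    then show ?case
      by (cases n) (simp_all add: \<theta>_mult \<theta>'_mult algebra_simps)
  qed
  then show "\<theta> (a ^ p) = 0" "\<theta>' (a ^ p) = 0"
    by (simp_all add: char_p)
qed

lemma \<phi>_eq_0_iff: "\<phi> a = 0 \<longleftrightarrow> a = 0"
proof
  assume "\<phi> a = 0"
  then show "a = 0"
    using \<phi>_mult[of a "inverse a"] \<phi>_1 by (cases "a = 0") auto
qed (simp add: \<phi>_0)

definition xop :: "'e endo" where
  "xop = Endo (\<lambda>m. \<xi> * m - \<theta> m)"

lemma app_xop: "app xop m = \<xi> * m - \<theta> m"
  unfolding xop_def by (subst Endo_inverse) (auto simp: \<theta>_add algebra_simps)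

lemma app_xop_power_eigen:
  assumes "\<theta> m = of_int l * m"
  shows "app (xop ^ n) m = (\<xi> - of_int l) ^ n * m"
  using assms
proof (induction n)
  case (Suc n)
  have t: "\<theta> ((\<xi> - of_int l) ^ n) = 0"
    by (induction n) (use \<theta>_of_int[of 1] in \<open>simp_all add: \<theta>_mult \<theta>_diff \<xi> \<theta>_of_int\<close>)
  show ?case
    using Suc by (simp add: app_xop \<theta>_mult t algebra_simps)
qed simp

lemma endo_eqI_eigen:
  assumes "\<And>m l. \<theta> m = of_int l * m \<Longrightarrow> app z m = app z' m"
  shows "z = z'"
proof (rule endo_eqI)
  fix m
  obtain M where M: "m = (\<Sum>i<p. M i)" "\<forall>i<p. \<theta> (M i) = of_nat i * M i"
    using eigen_decomp by blast
  then have "app z (M i) = app z' (M i)" if "i < p" for i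
    using that assms[of "M i" "int i"] by simp
  then show "app z m = app z' m"
    by (simp add: M(1) app_sum)
qed

text \<open>
  On an eigenvector with eigenvalue \<open>l\<close> this is \<open>(\<xi> - l)\<^sup>p = \<xi> + 1 - l\<close>, which holds because \<open>l\<close>
  lies in the prime field.
\<close>
lemma xop_relation: "xop ^ p = xop + 1"
proof (rule endo_eqI_eigen)
  fix m l assume m: "\<theta> m = of_int l * m"
  have "(\<xi> - of_int l + of_int l) ^ p = (\<xi> - of_int l) ^ p + of_int l ^ p"
    by (rule freshmans_dream) (simp_all add: CHAR_eq_prime[OF prime_p char_p] prime_p)
  then have pow: "(\<xi> - of_int l) ^ p = \<xi> - of_int l + 1"
    by (simp add: \<xi> of_int_power_prime_char[OF prime_p char_p] algebra_simps)
  then show "app (xop ^ p) m = app (xop + 1) m"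
    by (simp only: app_xop_power_eigen[OF m] pow) (simp add: app_xop m algebra_simps)
qed

lemma y_xop: "mult_op y * xop = (xop + 1) * mult_op y"
  by (rule endo_eqI) (simp add: app_xop \<theta>_mult y algebra_simps)

lemma xop_comm: "\<theta> e = 0 \<Longrightarrow> mult_op e * xop = xop * mult_op e"
  by (rule endo_eqI) (simp add: app_xop \<theta>_mult algebra_simps)

text \<open>
  The conditions survive left multiplication by \<open>xop\<close>, by \<open>y\<close> and by scalars; words
  in these span the image of the free algebra. The second condition says that the multipliers are
  conjugate under the Frobenius map, so that they share one value.
\<close>
definition homogeneous :: "'e endo \<Rightarrow> (int \<Rightarrow> 'e) \<Rightarrow> bool" where
  "homogeneous z u \<longleftrightarrow>
     (\<forall>l m. \<theta> m = of_int l * m \<longrightarrow> app z m = u l * m) \<and>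
     (\<forall>l. \<phi> (u l) = u (l - 1)) \<and> (\<forall>l. \<theta>' (u l) = 0)"

lemma homogeneous_add: "homogeneous z u \<Longrightarrow> homogeneous z' u' \<Longrightarrow> homogeneous (z + z') (\<lambda>l. u l + u' l)"
  unfolding homogeneous_def
proof (elim conjE, intro conjI allI impI)
  fix l m assume "\<forall>l m. \<theta> m = of_int l * m \<longrightarrow> app z m = u l * m"
    "\<forall>l m. \<theta> m = of_int l * m \<longrightarrow> app z' m = u' l * m" "\<theta> m = of_int l * m"
  then have "app z m = u l * m" "app z' m = u' l * m" by blast+
  then show "app (z + z') m = (u l + u' l) * m" by (simp add: distrib_right)
qed (simp_all add: \<phi>_add \<theta>'_add)

lemma homogeneous_mult_op:
  "homogeneous z u \<Longrightarrow> \<phi> e = e \<Longrightarrow> \<theta>' e = 0 \<Longrightarrow> homogeneous (mult_op e * z) (\<lambda>l. e * u l)"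
  by (auto simp: homogeneous_def \<phi>_mult \<theta>'_mult)

lemma homogeneous_xop:
  "homogeneous z u \<Longrightarrow> homogeneous (xop * z) (\<lambda>l. (\<xi> - of_int l) * u l - \<theta> (u l))"
  unfolding homogeneous_def
proof (elim conjE, intro conjI allI impI)
  fix l m assume u: "\<forall>l m. \<theta> m = of_int l * m \<longrightarrow> app z m = u l * m" and m: "\<theta> m = of_int l * m"
  show "app (xop * z) m = ((\<xi> - of_int l) * u l - \<theta> (u l)) * m"
  proof -
    have "app z m = u l * m" using u m by blast
    then show ?thesis by (simp add: app_xop \<theta>_mult m left_diff_distrib mult.assoc)
  qed
qed (simp_all add: \<phi>_diff \<phi>_mult \<phi>_of_int \<phi>_\<theta> \<xi> \<theta>'_diff \<theta>'_mult \<theta>'_of_int \<theta>_\<theta>' \<theta>_0)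

lemma homogeneous_1: "homogeneous 1 (\<lambda>_. 1)" and homogeneous_0: "homogeneous 0 (\<lambda>_. 0)"
  using \<theta>'_of_int[of 1] by (auto simp: homogeneous_def \<phi>_1 \<phi>_0 \<theta>'_0)

text \<open>
  Multiplication by a constant of \<open>\<theta>\<close> commutes with these operators. In particular this holds for a
  \<open>p\<close>-th power \<open>c\<^sup>p\<close> where \<open>c\<close> itself need not come from a scalar of the algebra.
\<close>
definition symbol_op :: "'e endo \<Rightarrow> bool" where
  "symbol_op z \<longleftrightarrow> (\<exists>u. homogeneous z u) \<and> (\<forall>e. \<theta> e = 0 \<longrightarrow> mult_op e * z = z * mult_op e)"

lemma symbol_op_add: "symbol_op z \<Longrightarrow> symbol_op z' \<Longrightarrow> symbol_op (z + z')"
  unfolding symbol_op_def by (auto simp: distrib_left distrib_right intro: homogeneous_add)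

lemma symbol_op_mult_op:
  assumes "symbol_op z" "\<phi> e = e" "\<theta>' e = 0"
  shows "symbol_op (mult_op e * z)"
proof -
  have "mult_op f * (mult_op e * z) = mult_op e * z * mult_op f" if "\<theta> f = 0" for f
  proof -
    have "mult_op f * mult_op e = mult_op e * mult_op f"
      by (simp flip: mult_op_mult add: mult.commute)
    moreover have "mult_op f * z = z * mult_op f"
      using assms(1) that unfolding symbol_op_def by blast
    ultimately show ?thesis
      by (metis mult.assoc)
  qed
  then show ?thesis
    using assms homogeneous_mult_op unfolding symbol_op_def by blast
qed

lemma symbol_op_xop:
  assumes "symbol_op z"
  shows "symbol_op (xop * z)"
proof -
  have "mult_op f * (xop * z) = xop * z * mult_op f" if "\<theta> f = 0" for f
  proof -
    have "mult_op f * z = z * mult_op f"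
      using assms that unfolding symbol_op_def by blast
    with xop_comm[OF that] show ?thesis
      by (metis mult.assoc)
  qed
  then show ?thesis
    using assms homogeneous_xop unfolding symbol_op_def by blast
qed

lemma symbol_op_0: "symbol_op 0" and symbol_op_1: "symbol_op 1"
  using homogeneous_0 homogeneous_1 unfolding symbol_op_def by auto

lemma symbol_op_word: "symbol_op (prod_list (map (case_xy xop (mult_op y)) w))"
proof (induction w)
  case (Cons l w)
  then show ?case
    using symbol_op_xop symbol_op_mult_op y by (cases l) simp_all
qed (simp add: symbol_op_1)

lemma symbol_op_free_eval:
  fixes \<kappa> :: "'f::comm_ring_1 \<Rightarrow> 'e"
  assumes "\<And>r. \<phi> (\<kappa> r) = \<kappa> r"
  shows "symbol_op (free_eval (\<lambda>r. mult_op (\<kappa> r ^ p)) (case_xy xop (mult_op y)) f)"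
proof -
  have "symbol_op (\<Sum>w\<in>A. mult_op (\<kappa> (g w) ^ p) * prod_list (map (case_xy xop (mult_op y)) (h w)))" for A g h
    by (induction A rule: infinite_finite_induct)
      (simp_all add: symbol_op_0 symbol_op_add symbol_op_mult_op symbol_op_word assms \<phi>_power \<theta>'_power_p)
  then show ?thesis
    unfolding free_eval_def .
qed

lemma lex_shift_less: "(a::int\<times>int) < b \<longleftrightarrow> w + a < w + b"
  by (cases a; cases b; cases w) auto

text \<open>
  Distinct values exclude cancellation of leading terms.
\<close>
lemma v_sum_distinct:
  assumes "finite I" "I \<noteq> {}" "\<And>i. i \<in> I \<Longrightarrow> f i \<noteq> 0" "inj_on (\<lambda>i. v (f i)) I"
  shows "\<exists>i\<in>I. sum f I \<noteq> 0 \<and> v (sum f I) = v (f i) \<and> (\<forall>j\<in>I. j \<noteq> i \<longrightarrow> v (f i) < v (f j))"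
  using assms
proof (induction I rule: finite_ne_induct)
  case (insert k I)
  then obtain i where i: "i \<in> I" "sum f I \<noteq> 0" "v (sum f I) = v (f i)"
    "\<forall>j\<in>I. j \<noteq> i \<longrightarrow> v (f i) < v (f j)"
    by (auto simp: inj_on_insert)
  have "k \<noteq> i" using i(1) insert by auto
  then have "v (f k) \<noteq> v (f i)"
    using insert.prems(2) i(1) unfolding inj_on_def by blast
  then consider "v (f k) < v (f i)" | "v (f i) < v (f k)"
    by (metis linorder_less_linear)
  then show ?case
  proof cases
    case 1
    then have "f k + sum f I \<noteq> 0 \<and> v (f k + sum f I) = v (f k)"
      using v_add[of "f k" "sum f I"] i insert.prems by auto
    moreover have "v (f k) < v (f j)" if "j \<in> I" for j
      using 1 i(4) that by (metis order.strict_trans)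
    ultimately show ?thesis
      using insert.hyps by (intro bexI[of _ k]) auto
  next
    case 2
    then have "f k + sum f I \<noteq> 0 \<and> v (f k + sum f I) = v (f i)"
      using v_add[of "sum f I" "f k"] i insert.prems by (auto simp: add.commute)
    then show ?thesis
      using insert.hyps i 2 by (intro bexI[of _ i]) auto
  qed
qed simp

lemma homogeneous_iterate: "homogeneous z u \<Longrightarrow> (u (int n) = 0 \<longleftrightarrow> u 0 = 0) \<and> v (u (int n)) = v (u 0)"
proof (induction n)
  case (Suc n)
  have "\<phi> (u (int (Suc n))) = u (int n)"
    using Suc.prems by (simp add: homogeneous_def)
  then have "v (u (int (Suc n))) = v (u (int n))" "u (int (Suc n)) = 0 \<longleftrightarrow> u (int n) = 0"
    using v_\<phi> \<phi>_eq_0_iff by metis+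
  with Suc show ?case by simp
qed simp

lemma homogeneous_zero: "homogeneous z u \<Longrightarrow> u 0 = 0 \<Longrightarrow> z = 0"
proof (rule endo_eqI)
  fix m assume z: "homogeneous z u" "u 0 = 0"
  obtain M where M: "m = (\<Sum>i<p. M i)" "\<forall>i<p. \<theta> (M i) = of_nat i * M i"
    using eigen_decomp by blast
  have "app z (M i) = 0" if "i < p" for i
  proof -
    have "app z (M i) = u (int i) * M i"
      using z(1) M(2) that unfolding homogeneous_def by simp
    then show ?thesis using homogeneous_iterate[OF z(1), of i] z(2) by simp
  qed
  then show "app z m = app 0 m"
    by (simp add: M(1) app_sum)
qed

text \<open>
  The eigencomponents of \<open>m\<close> have distinct values, because the eigenvalue is visible in the value.
  The operator multiplies them by series of one common value, so it preserves their order, and the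
  smallest component determines the value both before and after.
\<close>
lemma homogeneous_shift:
  assumes z: "homogeneous z u" "u 0 \<noteq> 0" and m: "m \<noteq> 0"
  shows "app z m \<noteq> 0 \<and> v (app z m) = v (u 0) + v m"
proof -
  obtain M where M: "m = (\<Sum>i<p. M i)" "\<forall>i<p. \<theta> (M i) = of_nat i * M i"
    using eigen_decomp by blast
  define I where "I = {i. i < p \<and> M i \<noteq> 0}"
  have I: "finite I" "m = sum M I"
    unfolding I_def M(1) by (auto intro!: sum.mono_neutral_right)
  then have "I \<noteq> {}" using m by auto
  have zM: "app z (M i) = u (int i) * M i" if "i \<in> I" for i
    using z(1) M(2) that unfolding homogeneous_def I_def by simp
  have nz: "u (int i) \<noteq> 0" "v (u (int i)) = v (u 0)" for i
    using homogeneous_iterate[OF z(1), of i] z(2) by auto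
  have vz: "app z (M i) \<noteq> 0" "v (app z (M i)) = v (u 0) + v (M i)" if "i \<in> I" for i
    using that v_mult[OF nz(1)[of i], of "M i"] by (auto simp: I_def zM nz)
  have inj: "inj_on (\<lambda>i. v (M i)) I"
  proof (rule inj_onI)
    fix i j assume ij: "i \<in> I" "j \<in> I" "v (M i) = v (M j)"
    have deg: "d (v (M k)) mod int p = int k" if "k \<in> I" for k
      by (rule v_eigen) (use that M(2) in \<open>auto simp: I_def\<close>)
    have "int i = int j"
      using deg[OF ij(1), unfolded ij(3)] deg[OF ij(2)] by (rule trans[OF sym])
    then show "i = j" by simp
  qed
  have MI: "M i \<noteq> 0" if "i \<in> I" for i
    using that by (simp add: I_def)
  obtain i where i: "i \<in> I" "v m = v (M i)" "\<forall>j\<in>I. j \<noteq> i \<longrightarrow> v (M i) < v (M j)"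
    using v_sum_distinct[OF I(1) \<open>I \<noteq> {}\<close> MI inj] unfolding I(2)[symmetric] by blast
  have inj': "inj_on (\<lambda>i. v (app z (M i))) I"
    using inj by (auto simp: inj_on_def vz)
  have zm: "app z m = (\<Sum>i\<in>I. app z (M i))"
    by (subst I(2)) (rule app_sum)
  obtain j where j: "j \<in> I" "app z m \<noteq> 0" "v (app z m) = v (app z (M j))"
      "\<forall>k\<in>I. k \<noteq> j \<longrightarrow> v (app z (M j)) < v (app z (M k))"
    using v_sum_distinct[OF I(1) \<open>I \<noteq> {}\<close> vz(1) inj'] unfolding zm[symmetric] by blast
  have "j = i"
  proof (rule ccontr)
    assume "j \<noteq> i"
    then have "v (M i) < v (M j)" "v (u 0) + v (M j) < v (u 0) + v (M i)"
      using i j by (auto simp: vz)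
    then show False using lex_shift_less by (meson order.asym)
  qed
  with j i vz show ?thesis by auto
qed

lemma homogeneous_power_shift:
  assumes z: "homogeneous z u" "u 0 \<noteq> 0" and m: "m \<noteq> 0"
  shows "app (z ^ n) m \<noteq> 0 \<and> fst (v (app (z ^ n) m)) = int n * fst (v (u 0)) + fst (v m)
     \<and> snd (v (app (z ^ n) m)) = int n * snd (v (u 0)) + snd (v m)"
proof (induction n)
  case (Suc n)
  then show ?case
    using homogeneous_shift[OF z, of "app (z ^ n) m"] by (simp add: algebra_simps)
qed (use m in simp)

lemma v_1: "v 1 = 0"
  using v_mult[of 1 1] by simp

lemma v_power: "a \<noteq> 0 \<Longrightarrow> fst (v (a ^ n)) = int n * fst (v a) \<and> snd (v (a ^ n)) = int n * snd (v a)"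
  by (induction n) (simp_all add: v_1 v_mult algebra_simps)

text \<open>
  The element \<open>c\<close> is free: \<open>z - c\<^sup>p\<close> is again a \<open>p\<close>-th root of a multiplication, and it is nonzero
  because \<open>z\<close> cannot be central. Comparing values of \<open>p\<close>-th powers then gives the value of the
  multiplier \<open>u\<close>.
\<close>
theorem value_of_pth_root:
  assumes ops: "symbol_op z" "symbol_op x"
    and rel: "z ^ p = mult_op (b ^ p)" "z * x = (x + 1) * z"
    and b: "b \<noteq> 0" and c: "\<phi> c = c"
  shows "\<exists>u. u \<noteq> 0 \<and> \<theta>' u = 0 \<and> b \<noteq> c ^ p \<and> v u = v (b - c ^ p)"
proof -
  define C where "C = mult_op (c ^ p)"
  have C_comm: "C * t = t * C" if "symbol_op t" for t
    using that \<theta>_power_p unfolding C_def symbol_op_def by blast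
  have C: "symbol_op (mult_op (- (c ^ p)) * 1)"
    by (rule symbol_op_mult_op) (simp_all add: symbol_op_1 \<phi>_minus \<theta>'_minus \<phi>_power c \<theta>'_power_p)
  have "mult_op (- (c ^ p)) = - C"
    unfolding C_def by (rule endo_eqI) (metis app_simps(6) app_simps(1,4) diff_0 minus_mult_left)
  with C have "symbol_op (- C)" by simp
  then have s: "symbol_op (z - C)" using symbol_op_add[OF ops(1)] by fastforce
  then obtain u where u: "homogeneous (z - C) u" unfolding symbol_op_def by blast
  have char: "of_nat p = (0 :: 'e endo)"
    using mult_op_of_nat[of p, where 'a = 'e] char_p by simp
  have "(z - C + C) ^ p = (z - C) ^ p + C ^ p"
    by (rule commuting_freshmans_dream) (use C_comm[OF s] prime_p char in simp_all)
  then have "(z - C) ^ p = mult_op (b ^ p) - mult_op ((c ^ p) ^ p)"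
    using rel(1) by (simp add: C_def mult_op_power)
  also have "\<dots> = mult_op ((b - c ^ p) ^ p)"
  proof -
    have "(b - c ^ p + c ^ p) ^ p = (b - c ^ p) ^ p + (c ^ p) ^ p"
      by (rule freshmans_dream) (simp_all add: CHAR_eq_prime[OF prime_p char_p] prime_p)
    then show ?thesis by (simp flip: mult_op_diff)
  qed
  finally have pow: "(z - C) ^ p = mult_op ((b - c ^ p) ^ p)" .
  \<comment> \<open>If \<open>u 0\<close> vanished, \<open>z\<close> would be central and the commutation relation would force \<open>z = 0\<close>.\<close>
  have u0: "u 0 \<noteq> 0"
  proof
    assume "u 0 = 0"
    then have "z = C" using homogeneous_zero[OF u] by simp
    then have "C * x = x * C + C" using rel(2) by (simp add: distrib_right)
    then have "C = 0" using C_comm[OF ops(2)] by simp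
    then have "mult_op (b ^ p) = 0" using \<open>z = C\<close> rel(1) p_pos by (simp add: power_0_left)
    then show False using b mult_op_eq_iff[of "b ^ p" 0] by simp
  qed
  have sh: "(b - c ^ p) ^ p \<noteq> 0 \<and> fst (v ((b - c ^ p) ^ p)) = int p * fst (v (u 0))
     \<and> snd (v ((b - c ^ p) ^ p)) = int p * snd (v (u 0))"
    using homogeneous_power_shift[OF u u0, of 1 p] by (simp add: pow v_1)
  then have nz: "b - c ^ p \<noteq> 0" using p_pos by (auto simp: power_0_left)
  have "v (u 0) = v (b - c ^ p)"
    using sh v_power[OF nz, of p] p_pos by (simp add: prod_eq_iff)
  then show ?thesis
    using u0 u nz unfolding homogeneous_def by (intro exI[of _ "u 0"]) auto
qed

end

unbundle fps_syntax

section \<open>Coefficientwise maps on Laurent series\<close>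

text \<open>
  The exponent is passed along so that the same construction covers \<open>t d/dt\<close>, the projections onto
  exponents in a residue class, and plain coefficientwise maps.
\<close>
definition fls_imap :: "(int \<Rightarrow> 'a::zero \<Rightarrow> 'b::zero) \<Rightarrow> 'a fls \<Rightarrow> 'b fls" where
  "fls_imap h f = Abs_fls (\<lambda>n. h n (f $$ n))"

lemma fls_imap_nth: "(\<And>n. h n 0 = 0) \<Longrightarrow> fls_imap h f $$ n = h n (f $$ n)"
  unfolding fls_imap_def
  by (rule fls_nth_vanishes_belowE[of f], rule nth_Abs_fls_ex_lower_bound) (metis (lifting))

text \<open>
  With bounds that are independent of the exact subdegrees, the product formula can be applied to a
  series and to its image under a map that shrinks the support.
\<close>
lemma fls_times_nth_bounds:
  fixes f g :: "'a::comm_ring_1 fls"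
  assumes f: "\<And>i. i < a \<Longrightarrow> f $$ i = 0" and g: "\<And>i. i < b \<Longrightarrow> g $$ i = 0"
  shows "(f * g) $$ n = (\<Sum>i=a..n - b. f $$ i * g $$ (n - i))"
proof (cases "f = 0 \<or> g = 0")
  case False
  then have "a \<le> fls_subdegree f" "b \<le> fls_subdegree g"
    using f g fls_subdegree_geI by blast+
  then show ?thesis
    unfolding fls_times_nth(2) by (intro sum.mono_neutral_left) auto
qed auto

lemma fls_imap_times:
  fixes f g :: "'a::comm_ring_1 fls" and h :: "int \<Rightarrow> 'a \<Rightarrow> 'b::comm_ring_1"
  assumes add: "\<And>n a b. h n (a + b) = h n a + h n b"
    and mult: "\<And>i j a b. h (i + j) (a * b) = h i a * h j b"
  shows "fls_imap h (f * g) = fls_imap h f * fls_imap h g"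
proof (rule fls_eqI)
  fix n
  have h0: "h n 0 = 0" for n using add[of n 0 0] by simp
  have h_sum: "h n (sum c A) = (\<Sum>i\<in>A. h n (c i))" for n and c :: "int \<Rightarrow> 'a" and A
    by (induction A rule: infinite_finite_induct) (simp_all add: h0 add)
  obtain a where a: "\<forall>i<a. f $$ i = 0" by (rule fls_nth_vanishes_belowE)
  obtain b where b: "\<forall>i<b. g $$ i = 0" by (rule fls_nth_vanishes_belowE)
  have "h n (f $$ i * g $$ (n - i)) = h i (f $$ i) * h (n - i) (g $$ (n - i))" for i
    using mult[of i "n - i" "f $$ i" "g $$ (n - i)"] by simp
  then show "fls_imap h (f * g) $$ n = (fls_imap h f * fls_imap h g) $$ n"
    using a b by (simp add: fls_imap_nth h0 h_sum fls_times_nth_bounds[of a _ b])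
qed

lemma fls_imap_derivation:
  fixes f g :: "'a::comm_ring_1 fls" and h :: "int \<Rightarrow> 'a \<Rightarrow> 'a"
  assumes add: "\<And>n a b. h n (a + b) = h n a + h n b"
    and mult: "\<And>i j a b. h (i + j) (a * b) = h i a * b + a * h j b"
  shows "fls_imap h (f * g) = fls_imap h f * g + f * fls_imap h g"
proof (rule fls_eqI)
  fix n
  have h0: "h n 0 = 0" for n using add[of n 0 0] by simp
  have h_sum: "h n (sum c A) = (\<Sum>i\<in>A. h n (c i))" for n and c :: "int \<Rightarrow> 'a" and A
    by (induction A rule: infinite_finite_induct) (simp_all add: h0 add)
  obtain a where a: "\<forall>i<a. f $$ i = 0" by (rule fls_nth_vanishes_belowE)
  obtain b where b: "\<forall>i<b. g $$ i = 0" by (rule fls_nth_vanishes_belowE)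
  have "h n (f $$ i * g $$ (n - i)) = h i (f $$ i) * g $$ (n - i) + f $$ i * h (n - i) (g $$ (n - i))" for i
    using mult[of i "n - i" "f $$ i" "g $$ (n - i)"] by simp
  then show "fls_imap h (f * g) $$ n = (fls_imap h f * g + f * fls_imap h g) $$ n"
    using a b by (simp add: fls_imap_nth h0 h_sum fls_times_nth_bounds[of a _ b] sum.distrib)
qed

lemma fls_imap_add:
  fixes h :: "int \<Rightarrow> 'a::comm_ring_1 \<Rightarrow> 'b::comm_ring_1"
  assumes add: "\<And>n a b. h n (a + b) = h n a + h n b"
  shows "fls_imap h (f + g) = fls_imap h f + fls_imap h g"
proof -
  have h0: "h n 0 = 0" for n using add[of n 0 0] by simp
  show ?thesis by (rule fls_eqI) (simp add: fls_imap_nth h0 add)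
qed

abbreviation fls_map :: "('a::zero \<Rightarrow> 'b::zero) \<Rightarrow> 'a fls \<Rightarrow> 'b fls" where
  "fls_map h \<equiv> fls_imap (\<lambda>_. h)"

lemma fls_map_const: "h 0 = 0 \<Longrightarrow> fls_map h (fls_const c) = fls_const (h c)"
  by (rule fls_eqI) (simp add: fls_imap_nth)

lemma fls_map_1: "h 0 = 0 \<Longrightarrow> h 1 = 1 \<Longrightarrow> fls_map h 1 = 1"
  by (rule fls_eqI) (simp add: fls_imap_nth)

lemma fls_map_X: "h 0 = 0 \<Longrightarrow> h 1 = 1 \<Longrightarrow> fls_map h fls_X = fls_X"
  by (rule fls_eqI) (simp add: fls_imap_nth)

lemma fls_map_0: "h 0 = 0 \<Longrightarrow> fls_map h 0 = 0"
  by (rule fls_eqI) (simp add: fls_imap_nth)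

lemma fls_map_eq_0_iff: "(\<And>a. h a = 0 \<longleftrightarrow> a = 0) \<Longrightarrow> fls_map h f = 0 \<longleftrightarrow> f = 0"
  by (metis fls_eqI fls_imap_nth fls_zero_nth)

lemma fls_map_subdegree: "(\<And>a. h a = 0 \<longleftrightarrow> a = 0) \<Longrightarrow> fls_subdegree (fls_map h f) = fls_subdegree f"
proof (cases "f = 0")
  case False
  assume h: "\<And>a. h a = 0 \<longleftrightarrow> a = 0"
  show ?thesis
    by (rule fls_subdegree_eqI) (use False h in \<open>simp_all add: fls_imap_nth\<close>)
qed (simp add: fls_map_0)

section \<open>The Euler derivation and the Frobenius endomorphism\<close>

text \<open>
  The derivation \<open>t d/dt\<close>. Unlike \<open>d/dt\<close> it preserves exponents, and its eigenvalues are the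
  exponents modulo the characteristic.
\<close>
definition euler :: "'a::comm_ring_1 fls \<Rightarrow> 'a fls" where
  "euler = fls_imap (\<lambda>n a. of_int n * a)"

lemma euler_nth [simp]: "euler f $$ n = of_int n * f $$ n"
  by (simp add: euler_def fls_imap_nth)

lemma euler_0 [simp]: "euler 0 = 0" and euler_const [simp]: "euler (fls_const c) = 0"
  and euler_X [simp]: "euler fls_X = fls_X"
  by (rule fls_eqI; simp)+

lemma euler_1 [simp]: "euler 1 = 0"
  using euler_const[of 1] by simp

lemma map_euler_X: "fls_map euler fls_X = (0 :: 'a::comm_ring_1 fls fls)"
  by (rule fls_eqI) (simp add: fls_imap_nth)

lemma euler_add: "euler (f + g) = euler f + euler g"
  unfolding euler_def by (rule fls_imap_add) (simp add: distrib_left)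

lemma euler_mult: "euler (f * g) = euler f * g + f * euler g"
  unfolding euler_def by (rule fls_imap_derivation) (simp_all add: algebra_simps)

lemma euler_of_int_mult: "euler (of_int n * f) = of_int n * euler f"
  by (rule fls_eqI) (simp add: mult.left_commute)

lemma fls_subdegree_power:
  fixes f :: "'a::idom fls"
  shows "f \<noteq> 0 \<Longrightarrow> fls_subdegree (f ^ n) = int n * fls_subdegree f"
  by (induction n) (simp_all add: algebra_simps)

text \<open>
  For finite sums of monomials this is the additivity of \<open>p\<close>-th powers. A tail starting beyond \<open>|n|\<close>
  has a \<open>p\<close>-th power that starts beyond \<open>n\<close> and so does not influence the coefficient.
\<close>
lemma fls_power_CHAR_nth:
  fixes f :: "'a::idom fls"
  assumes p: "prime p" and char: "CHAR('a) = p"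
  shows "(f ^ p) $$ n = (if int p dvd n then (f $$ (n div int p)) ^ p else 0)"
proof -
  have p0: "p > 0" using p by (simp add: prime_gt_0_nat)
  have z: "(0::'a) ^ p = 0" using p0 by (simp add: zero_power)
  have fd: "(a + b) ^ p = a ^ p + b ^ p" for a b :: 'a
    by (rule freshmans_dream) (simp_all add: char p)
  have fdf: "(a + b) ^ p = a ^ p + b ^ p" for a b :: "'a fls"
    by (rule freshmans_dream) (simp_all add: char p)
  define mono :: "'a \<Rightarrow> int \<Rightarrow> 'a fls" where "mono a i = fls_const a * fls_X_intpow i" for a i
  have mono_nth: "mono a i $$ j = (if j = i then a else 0)" for a i j
    by (simp add: mono_def)
  have mono_pow: "mono a i ^ p = mono (a ^ p) (int p * i)" for a i
    by (simp add: mono_def power_mult_distrib fls_const_power fls_X_intpow_power)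
  obtain a where a: "\<forall>i<a. f $$ i = 0" by (rule fls_nth_vanishes_belowE)
  define g where "g = (\<Sum>i\<in>{a..\<bar>n\<bar>}. mono (f $$ i) i)"
  define r where "r = f - g"
  have g_nth: "g $$ j = (if j \<le> \<bar>n\<bar> then f $$ j else 0)" for j
  proof -
    have "g $$ j = (\<Sum>i\<in>{a..\<bar>n\<bar>}. if j = i then f $$ i else 0)"
      by (simp add: g_def fls_nth_sum mono_nth)
    then show ?thesis using a by (auto simp: sum.delta')
  qed
  have r_nth: "r $$ j = 0" if "j \<le> \<bar>n\<bar>" for j
    using that by (simp add: r_def g_nth)
  have rp: "(r ^ p) $$ n = 0"
  proof (cases "r = 0")
    case False
    then have "\<bar>n\<bar> + 1 \<le> fls_subdegree r"
      using r_nth by (intro fls_subdegree_geI) auto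
    then have "fls_subdegree (r ^ p) > n"
      using mult_mono[of 1 "int p" "\<bar>n\<bar> + 1" "fls_subdegree r"] p0
      by (simp add: fls_subdegree_power[OF False])
    then show ?thesis by (rule fls_eq0_below_subdegree)
  qed (use p0 in \<open>simp add: zero_power\<close>)
  have "(f ^ p) $$ n = (g ^ p) $$ n"
  proof -
    have "f = g + r" by (simp add: r_def)
    then have "f ^ p = g ^ p + r ^ p" by (simp only: fdf)
    then show ?thesis by (simp add: rp)
  qed
  also have "g ^ p = (\<Sum>i\<in>{a..\<bar>n\<bar>}. mono ((f $$ i) ^ p) (int p * i))"
    unfolding g_def mono_pow[symmetric] by (rule freshmans_dream_sum) (simp_all add: char p)
  also have "\<dots> $$ n = (\<Sum>i\<in>{a..\<bar>n\<bar>}. if n = int p * i then (f $$ i) ^ p else 0)"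
    by (simp add: fls_nth_sum mono_nth)
  also have "\<dots> = (if int p dvd n then (f $$ (n div int p)) ^ p else 0)"
  proof (cases "int p dvd n")
    case True
    then obtain k where k: "n = int p * k" ..
    have "k \<le> \<bar>n\<bar>"
    proof -
      have "\<bar>k\<bar> * 1 \<le> \<bar>k\<bar> * int p" using p0 by (intro mult_left_mono) auto
      then show ?thesis by (simp add: k abs_mult mult.commute)
    qed
    have "(\<Sum>i\<in>{a..\<bar>n\<bar>}. if n = int p * i then (f $$ i) ^ p else 0)
        = (\<Sum>i\<in>{a..\<bar>n\<bar>}. if k = i then (f $$ i) ^ p else 0)"
      using p0 by (simp add: k)
    also have "\<dots> = (f $$ k) ^ p"
      using a \<open>k \<le> \<bar>n\<bar>\<close> by (auto simp: sum.delta' z)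
    finally show ?thesis using p0 by (simp add: k)
  next
    case False
    then have "(\<Sum>i\<in>{a..\<bar>n\<bar>}. if n = int p * i then (f $$ i) ^ p else 0) = 0"
      by (intro sum.neutral) auto
    with False show ?thesis by simp
  qed
  finally show ?thesis .
qed

section \<open>Iterated Laurent series\<close>

text \<open>
  The outer variable is the more significant one in the lexicographic order of pairs.
\<close>
definition lex_val :: "'a::zero fls fls \<Rightarrow> int \<times> int" where
  "lex_val f = (fls_subdegree f, fls_subdegree (f $$ fls_subdegree f))"

lemma nth_lex_val: "f \<noteq> 0 \<Longrightarrow> f $$ fst (lex_val f) $$ snd (lex_val f) \<noteq> 0"
  by (simp add: lex_val_def)

lemma lex_val_mult:
  fixes f g :: "'a::field fls fls"
  shows "f \<noteq> 0 \<Longrightarrow> g \<noteq> 0 \<Longrightarrow> lex_val (f * g) = lex_val f + lex_val g"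
  by (simp add: lex_val_def)

lemma lex_val_add:
  fixes f g :: "'a::field fls fls"
  assumes f: "f \<noteq> 0" and g: "g \<noteq> 0" and less: "lex_val f < lex_val g"
  shows "f + g \<noteq> 0 \<and> lex_val (f + g) = lex_val f"
proof -
  let ?n = "fls_subdegree f"
  have fn: "f $$ ?n \<noteq> 0" using f by simp
  have n: "?n \<le> fls_subdegree g"
    using less by (auto simp: lex_val_def)
  have key: "(f + g) $$ ?n \<noteq> 0 \<and> fls_subdegree ((f + g) $$ ?n) = fls_subdegree (f $$ ?n)"
  proof (cases "?n < fls_subdegree g")
    case True
    then show ?thesis using fn by simp
  next
    case False
    then have eq: "fls_subdegree g = ?n" using n by simp
    then have l: "fls_subdegree (f $$ ?n) < fls_subdegree (g $$ ?n)"
      using less by (simp add: lex_val_def)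
    let ?k = "fls_subdegree (f $$ ?n)"
    have nz: "(f $$ ?n + g $$ ?n) $$ ?k \<noteq> 0" using fn l by simp
    moreover have "fls_subdegree (f $$ ?n + g $$ ?n) = ?k"
      by (rule fls_subdegree_eqI[OF nz]) (use l in simp)
    ultimately show ?thesis by (auto simp: fls_nonzeroI)
  qed
  have "fls_subdegree (f + g) = ?n"
    by (rule fls_subdegree_eqI) (use key n in auto)
  moreover have "f + g \<noteq> 0"
    using key fls_nonzeroI by blast
  ultimately show ?thesis
    using key by (simp add: lex_val_def)
qed

lemma lex_val_map:
  assumes "\<And>a. h a = 0 \<longleftrightarrow> a = 0"
  shows "lex_val (fls_map (fls_map h) f) = lex_val f"
proof -
  have h2: "fls_map h a = 0 \<longleftrightarrow> a = 0" for a
    by (rule fls_map_eq_0_iff) (rule assms)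
  have "fls_subdegree (fls_map (fls_map h) f) = fls_subdegree f"
    by (rule fls_map_subdegree) (rule h2)
  then show ?thesis
    using h2 by (simp add: lex_val_def fls_imap_nth fls_map_subdegree assms)
qed

lemma subdegree_euler_eigen:
  fixes f :: "'a::idom fls"
  assumes char: "CHAR('a) = p" and f: "f \<noteq> 0" "euler f = of_nat i * f" "i < p"
  shows "fls_subdegree f mod int p = int i"
proof -
  let ?n = "fls_subdegree f"
  have "euler f $$ ?n = (of_nat i * f) $$ ?n" using f(2) by simp
  then have "of_int ?n * f $$ ?n = of_int (int i) * f $$ ?n" by simp
  then have "(of_int ?n :: 'a) = of_int (int i)" using f(1) by simp
  then have "(of_int (?n - int i) :: 'a) = 0" by simp
  then have "int p dvd ?n - int i"
    by (simp only: of_int_eq_0_iff_char_dvd char)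
  then have "?n mod int p = int i mod int p"
    by (simp only: mod_eq_dvd_iff)
  then show ?thesis using f(3) by simp
qed

definition euler_part :: "nat \<Rightarrow> nat \<Rightarrow> 'a::comm_ring_1 fls \<Rightarrow> 'a fls" where
  "euler_part p i = fls_imap (\<lambda>n a. if n mod int p = int i then a else 0)"

lemma euler_part_nth: "euler_part p i f $$ n = (if n mod int p = int i then f $$ n else 0)"
  by (simp add: euler_part_def fls_imap_nth)

lemma euler_part_sum: "p > 0 \<Longrightarrow> (\<Sum>i<p. euler_part p i f) = f"
proof (rule fls_eqI)
  fix n assume "p > 0"
  then have "n mod int p = int i \<longleftrightarrow> nat (n mod int p) = i" for i by auto
  moreover have "nat (n mod int p) < p" using \<open>p > 0\<close> by (simp add: nat_less_iff)
  ultimately show "(\<Sum>i<p. euler_part p i f) $$ n = f $$ n"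
    by (simp add: fls_nth_sum euler_part_nth)
qed

lemma euler_part_eigen:
  fixes f :: "'a::comm_ring_1 fls"
  assumes "of_nat p = (0::'a)"
  shows "euler (euler_part p i f) = of_nat i * euler_part p i f"
proof (rule fls_eqI)
  fix n
  have "(of_int n :: 'a) = of_nat i" if "n mod int p = int i"
  proof -
    have "n = int p * (n div int p) + int i" using that by (metis mult_div_mod_eq)
    then have "(of_int n :: 'a) = of_nat p * of_int (n div int p) + of_nat i"
      by (metis of_int_add of_int_mult of_int_of_nat_eq)
    then show ?thesis by (simp add: assms)
  qed
  then show "euler (euler_part p i f) $$ n = (of_nat i * euler_part p i f) $$ n"
    by (simp add: euler_part_nth)
qed

context
  fixes p :: nat
  assumes p: "prime p" and char: "CHAR('a::field) = p"
begin

abbreviation "frob \<equiv> fls_map (fls_map (\<lambda>a::'a. a ^ p))"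

lemma p0: "p > 0"
  using p by (simp add: prime_gt_0_nat)

lemma pow_eq_0_iff: "(a::'a) ^ p = 0 \<longleftrightarrow> a = 0"
  using p0 by simp

lemma pow_add: "(a + b :: 'a) ^ p = a ^ p + b ^ p"
  by (rule freshmans_dream) (simp_all add: char p)

lemma frob_inner: "fls_map (\<lambda>a::'a. a ^ p) 0 = 0" "fls_map (\<lambda>a::'a. a ^ p) 1 = 1"
  "fls_map (\<lambda>a::'a. a ^ p) (f + g) = fls_map (\<lambda>a::'a. a ^ p) f + fls_map (\<lambda>a::'a. a ^ p) g"
  "fls_map (\<lambda>a::'a. a ^ p) (f * g) = fls_map (\<lambda>a::'a. a ^ p) f * fls_map (\<lambda>a::'a. a ^ p) g"
  by (intro fls_map_0 fls_map_1 fls_imap_add fls_imap_times; simp add: p0 pow_add power_mult_distrib)+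

lemma frob_add: "frob (f + g) = frob f + frob g" and frob_mult: "frob (f * g) = frob f * frob g"
  and frob_1: "frob 1 = 1"
  by (rule fls_imap_add fls_imap_times fls_map_1; simp only: frob_inner)+

lemma of_nat_p: "of_nat p = (0 :: 'a)"
  using char of_nat_CHAR by auto

lemma frob_inner_euler: "fls_map (\<lambda>a::'a. a ^ p) (euler f) = euler (fls_map (\<lambda>a. a ^ p) f)"
  by (rule fls_eqI)
    (simp add: fls_imap_nth p0 zero_power power_mult_distrib of_int_power_prime_char[OF p of_nat_p])

lemma frob_inner_of_int: "fls_map (\<lambda>a::'a. a ^ p) (of_int n * f) = of_int n * fls_map (\<lambda>a. a ^ p) f"
  by (rule fls_eqI)
    (simp add: fls_imap_nth p0 zero_power power_mult_distrib of_int_power_prime_char[OF p of_nat_p])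

lemma frob_euler: "frob (euler f) = euler (frob f)"
  by (rule fls_eqI) (simp add: fls_imap_nth frob_inner(1) frob_inner_of_int)

lemma frob_map_euler: "frob (fls_map euler f) = fls_map euler (frob f)"
  by (rule fls_eqI) (simp add: fls_imap_nth frob_inner frob_inner_euler)

lemma of_nat_p_fls: "of_nat p = (0 :: 'a fls)" "of_nat p = (0 :: 'a fls fls)"
  by (simp_all add: fls_of_nat of_nat_p)

lemma map_euler_add: "fls_map euler (f + g) = fls_map euler f + fls_map euler (g :: 'a fls fls)"
  by (rule fls_imap_add) (rule euler_add)

lemma map_euler_mult: "fls_map euler (f * g) = fls_map euler f * g + f * fls_map euler (g :: 'a fls fls)"
  by (rule fls_imap_derivation) (rule euler_add euler_mult)+

lemma euler_map_euler: "euler (fls_map euler f) = fls_map euler (euler (f :: 'a fls fls))"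
  by (rule fls_eqI) (simp add: fls_imap_nth euler_of_int_mult)

context
  fixes \<xi> :: 'a
  assumes \<xi>: "\<xi> ^ p = \<xi> + 1"
begin

lemma xi_power: "fls_const (fls_const \<xi>) ^ p = fls_const (fls_const \<xi>) + 1"
  by (simp flip: fls_const_power add: \<xi>) (metis fls_const_1 fls_plus_const)

lemma frob_xi: "frob (fls_const (fls_const \<xi>)) = fls_const (fls_const \<xi>) + 1"
  using xi_power by (simp add: fls_map_const frob_inner p0 zero_power fls_const_power)

lemma val_frob: "lex_val (frob f) = lex_val f"
  by (rule lex_val_map) (rule pow_eq_0_iff)

lemma outer_twisted_derivation:
  "twisted_derivation p euler (fls_map euler) frob (fls_const (fls_const \<xi>)) fls_X lex_val fst"
proof
  fix m :: "'a fls fls"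
  show "\<exists>M. m = (\<Sum>i<p. M i) \<and> (\<forall>i<p. euler (M i) = of_nat i * M i)"
    by (intro exI[of _ "\<lambda>i. euler_part p i m"])
      (simp add: euler_part_sum p0 euler_part_eigen of_nat_p_fls)
next
  fix m :: "'a fls fls" and i assume "m \<noteq> 0" "euler m = of_nat i * m" "i < p"
  then show "fst (lex_val m) mod int p = int i"
    unfolding lex_val_def by (simp add: subdegree_euler_eigen char)
qed (simp_all add: p of_nat_p_fls euler_add euler_mult map_euler_add map_euler_mult euler_map_euler
    frob_add frob_mult frob_1 frob_euler xi_power frob_xi fls_map_const map_euler_X fls_map_X fls_map_0 frob_inner
    lex_val_mult lex_val_add val_frob)

lemma inner_twisted_derivation:
  "twisted_derivation p (fls_map euler) euler frob (fls_const (fls_const \<xi>)) (fls_const fls_X) lex_val snd"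
proof
  fix m :: "'a fls fls"
  show "\<exists>M. m = (\<Sum>i<p. M i) \<and> (\<forall>i<p. fls_map euler (M i) = of_nat i * M i)"
  proof (intro exI[of _ "\<lambda>i. fls_map (euler_part p i) m"] conjI allI impI)
    have 0: "euler_part p i 0 = (0 :: 'a fls)" for i
      by (rule fls_eqI) (simp add: euler_part_nth)
    show "m = (\<Sum>i<p. fls_map (euler_part p i) m)"
      by (rule fls_eqI) (simp add: fls_nth_sum fls_imap_nth 0 euler_part_sum p0)
    show "fls_map euler (fls_map (euler_part p i) m) = of_nat i * fls_map (euler_part p i) m" for i
      by (rule fls_eqI) (simp add: fls_imap_nth 0 euler_part_eigen of_nat_p)
  qed
next
  fix m :: "'a fls fls" and i assume m: "m \<noteq> 0" "fls_map euler m = of_nat i * m" "i < p"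
  let ?n = "fls_subdegree m"
  have "fls_map euler m $$ ?n = (of_nat i * m) $$ ?n" using m(2) by simp
  then have "euler (m $$ ?n) = of_nat i * m $$ ?n" by (simp add: fls_imap_nth)
  then show "snd (lex_val m) mod int p = int i"
    unfolding lex_val_def using m by (simp add: subdegree_euler_eigen char)
qed (simp_all add: p of_nat_p_fls euler_add euler_mult map_euler_add map_euler_mult euler_map_euler
    frob_add frob_mult frob_1 frob_map_euler xi_power frob_xi fls_map_const fls_map_X fls_map_0 frob_inner p0 zero_power
    lex_val_mult lex_val_add val_frob)

end

text \<open>
  The coefficients of \<open>b\<close> lie in the field with \<open>p\<close> elements, so they are their own \<open>p\<close>-th powers.
  Hence the terms of \<open>b\<close> with both exponents divisible by \<open>p\<close> add up to \<open>c\<^sup>p\<close>, where \<open>c\<close> has the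
  same coefficients at the exponents divided by \<open>p\<close>.
\<close>
lemma subtract_pth_power:
  fixes b :: "'a fls fls"
  assumes b: "frob b = b"
  shows "\<exists>c. frob c = c \<and> (b = c ^ p \<or>
    \<not> (fst (lex_val (b - c ^ p)) mod int p = 0 \<and> snd (lex_val (b - c ^ p)) mod int p = 0))"
proof -
  have b_nth: "(b $$ m $$ n) ^ p = b $$ m $$ n" for m n
  proof -
    have "frob b $$ m $$ n = b $$ m $$ n" using b by simp
    then show ?thesis by (simp add: fls_imap_nth frob_inner p0 zero_power)
  qed
  define sub :: "'a fls \<Rightarrow> 'a fls" where "sub f = Abs_fls (\<lambda>n. f $$ (int p * n))" for f
  define c where "c = Abs_fls (\<lambda>m. sub (b $$ (int p * m)))"
  have below: "\<exists>N. \<forall>n<N. g (f $$ (int p * n)) = 0" if "g 0 = 0"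
    for f :: "'x::zero fls" and g :: "'x \<Rightarrow> 'z::zero"
  proof -
    obtain a where a: "\<forall>i<a. f $$ i = 0" by (rule fls_nth_vanishes_belowE)
    have "int p * n < a" if "n < - \<bar>a\<bar>" for n
    proof -
      have "1 * (- n) \<le> int p * (- n)" using that p0 by (intro mult_right_mono) auto
      then show ?thesis using that by simp
    qed
    then show ?thesis using a that by (intro exI[of _ "- \<bar>a\<bar>"]) auto
  qed
  have sub_nth: "sub f $$ n = f $$ (int p * n)" for f n
    unfolding sub_def by (rule nth_Abs_fls_ex_lower_bound) (rule below[of "\<lambda>x. x"], simp)
  have sub0: "sub 0 = 0"
    by (rule fls_eqI) (simp add: sub_nth)
  have c_nth: "c $$ m = sub (b $$ (int p * m))" for m
    unfolding c_def by (rule nth_Abs_fls_ex_lower_bound) (rule below, rule sub0)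
  have c_frob: "frob c = c"
    by (intro fls_eqI) (simp add: fls_imap_nth frob_inner p0 zero_power c_nth sub_nth b_nth)
  have cp_nth: "(c ^ p) $$ m $$ n = (if int p dvd m \<and> int p dvd n then b $$ m $$ n else 0)" for m n
    by (auto simp: fls_power_CHAR_nth[OF p] char c_nth sub_nth b_nth)
  show ?thesis
  proof (intro exI[of _ c] conjI c_frob disjCI)
    assume "\<not> \<not> (fst (lex_val (b - c ^ p)) mod int p = 0 \<and> snd (lex_val (b - c ^ p)) mod int p = 0)"
    then have d: "int p dvd fst (lex_val (b - c ^ p))" "int p dvd snd (lex_val (b - c ^ p))"
      by (simp_all add: mod_eq_0_iff_dvd)
    show "b = c ^ p"
    proof (rule ccontr)
      assume "b \<noteq> c ^ p"
      then have "(b - c ^ p) $$ fst (lex_val (b - c ^ p)) $$ snd (lex_val (b - c ^ p)) \<noteq> 0"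
        by (intro nth_lex_val) simp
      then show False using d by (simp add: cp_nth)
    qed
  qed
qed

end

section \<open>Linked symbol algebras\<close>

context twisted_derivation
begin

text \<open>
  Scalars act through \<open>p\<close>-th powers because \<open>y\<^sup>p\<close>, and not \<open>y\<close>, must be the action of \<open>b0\<close>.
  This also makes them constants for both derivations.
\<close>
lemma value_of_linked_slot:
  fixes \<kappa> :: "'f::field \<Rightarrow> 'e"
  assumes \<kappa>: "\<And>r s. \<kappa> (r + s) = \<kappa> r + \<kappa> s" "\<And>r s. \<kappa> (r * s) = \<kappa> r * \<kappa> s" "\<kappa> 1 = 1"
      "\<And>r. \<phi> (\<kappa> r) = \<kappa> r"
    and b0: "\<kappa> b0 = y"
    and iso: "algebra_iso (p_symbol p 1 b0) (p_symbol p a b)"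
    and b: "b \<noteq> 0" and c: "\<phi> c = c"
  shows "\<exists>u. u \<noteq> 0 \<and> \<theta>' u = 0 \<and> \<kappa> b \<noteq> c ^ p \<and> v u = v (\<kappa> b - c ^ p)"
proof -
  let ?c = "\<lambda>r. mult_op (\<kappa> r ^ p)" and ?g = "case_xy xop (mult_op y)"
  have hom: "free_eval_hom ?c ?g"
  proof
    show "?c (r + s) = ?c r + ?c s" for r s
    proof -
      have "(\<kappa> r + \<kappa> s) ^ p = \<kappa> r ^ p + \<kappa> s ^ p"
        by (rule freshmans_dream) (simp_all add: CHAR_eq_prime[OF prime_p char_p] prime_p)
      then show ?thesis by (simp only: \<kappa> mult_op_add)
    qed
    show "?c r * ?g l = ?g l * ?c r" for r l
    proof (cases l)
      case GenX
      then show ?thesis by (simp add: xop_comm \<theta>_power_p)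
    next
      case GenY
      then show ?thesis by (simp add: mult.commute[of _ y] flip: mult_op_mult)
    qed
  qed (simp_all add: \<kappa> power_mult_distrib mult_op_mult)
  obtain x z where xz: "x \<in> range (free_eval ?c ?g)" "z \<in> range (free_eval ?c ?g)"
    "z ^ p = ?c b" "z * x = (x + 1) * z"
    using p_symbol_iso_image[OF hom _ _ _ iso p_pos b]
    by (auto simp: xop_relation \<kappa> b0 mult_op_power y_xop)
  have "symbol_op x" "symbol_op z"
    using xz(1,2) symbol_op_free_eval[of \<kappa>, OF \<kappa>(4)] by auto
  moreover have "\<kappa> b \<noteq> 0"
    using \<kappa>(2)[of b "inverse b"] \<kappa>(3) b by auto
  ultimately show ?thesis
    using value_of_pth_root xz(3,4) c by blast
qed

end

text \<open>
  The same value \<open>v(\<kappa> b - c\<^sup>p)\<close> is the value of a series killed by \<open>t d/dt\<close> and of a series killed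
  by \<open>s d/ds\<close>, so \<open>p\<close> divides both of its components.
\<close>
lemma not_right_linked_of_embedding:
  fixes \<kappa> :: "'f::field \<Rightarrow> 'a::field fls fls" and p :: nat
  assumes p: "prime p" and char: "CHAR('a) = p" and \<xi>: "\<xi> ^ p = (\<xi> :: 'a) + 1"
    and \<kappa>: "\<And>r s. \<kappa> (r + s) = \<kappa> r + \<kappa> s" "\<And>r s. \<kappa> (r * s) = \<kappa> r * \<kappa> s" "\<kappa> 1 = 1"
      "\<And>r. fls_map (fls_map (\<lambda>a. a ^ p)) (\<kappa> r) = \<kappa> r"
    and \<alpha>: "\<kappa> \<alpha> = fls_const fls_X" and \<beta>: "\<kappa> \<beta> = fls_X"
  shows "\<not> right_linked p (p_symbol p 1 \<alpha>) (p_symbol p 1 \<beta>)"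
proof
  assume "right_linked p (p_symbol p 1 \<alpha>) (p_symbol p 1 \<beta>)"
  then obtain a a' b where b: "b \<noteq> 0"
      and iso: "algebra_iso (p_symbol p 1 \<alpha>) (p_symbol p a b)" "algebra_iso (p_symbol p 1 \<beta>) (p_symbol p a' b)"
    unfolding right_linked_def by blast
  interpret inner: twisted_derivation p "fls_map euler" euler "fls_map (fls_map (\<lambda>a::'a. a ^ p))"
      "fls_const (fls_const \<xi>)" "fls_const fls_X" lex_val snd
    by (rule inner_twisted_derivation[OF p char \<xi>])
  interpret outer: twisted_derivation p euler "fls_map euler" "fls_map (fls_map (\<lambda>a::'a. a ^ p))"
      "fls_const (fls_const \<xi>)" fls_X lex_val fst
    by (rule outer_twisted_derivation[OF p char \<xi>])
  obtain c where c: "fls_map (fls_map (\<lambda>a. a ^ p)) c = c"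
    "\<kappa> b = c ^ p \<or> \<not> (fst (lex_val (\<kappa> b - c ^ p)) mod int p = 0 \<and> snd (lex_val (\<kappa> b - c ^ p)) mod int p = 0)"
    using subtract_pth_power[OF p char \<kappa>(4)[of b]] by blast
  have "\<exists>u :: 'a fls fls. u \<noteq> 0 \<and> euler u = 0 \<and> \<kappa> b \<noteq> c ^ p \<and> lex_val u = lex_val (\<kappa> b - c ^ p)"
    by (rule inner.value_of_linked_slot[where \<kappa> = \<kappa>, OF \<kappa> \<alpha> iso(1) b c(1)])
  then obtain u :: "'a fls fls" where u: "u \<noteq> 0" "euler u = 0" "\<kappa> b \<noteq> c ^ p" "lex_val u = lex_val (\<kappa> b - c ^ p)"
    by blast
  have "\<exists>w :: 'a fls fls. w \<noteq> 0 \<and> fls_map euler w = 0 \<and> \<kappa> b \<noteq> c ^ p \<and> lex_val w = lex_val (\<kappa> b - c ^ p)"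
    by (rule outer.value_of_linked_slot[where \<kappa> = \<kappa>, OF \<kappa> \<beta> iso(2) b c(1)])
  then obtain w :: "'a fls fls" where w: "w \<noteq> 0" "fls_map euler w = 0" "lex_val w = lex_val (\<kappa> b - c ^ p)"
    by blast
  \<comment> \<open>The derivation that kills \<open>u\<close> is the one of the other action: \<open>u\<close> is an eigenvector for it.\<close>
  have "fst (lex_val u) mod int p = 0"
    using outer.v_eigen[of u 0] u inner.p_pos by simp
  moreover have "snd (lex_val w) mod int p = 0"
    using inner.v_eigen[of w 0] w inner.p_pos by simp
  ultimately show False
    using c(2) u w by simp
qed

section \<open>Embedding the two fields\<close>

definition fract_lift :: "('r::idom \<Rightarrow> 'e::field) \<Rightarrow> 'r fract \<Rightarrow> 'e" where
  "fract_lift h q = (SOME e. \<exists>a b. b \<noteq> 0 \<and> q = Fraction_Field.Fract a b \<and> e = h a / h b)"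

context
  fixes h :: "'r::idom \<Rightarrow> 'e::field"
  assumes h_add: "h (a + b) = h a + h b" and h_mult: "h (a * b) = h a * h b"
    and h_1: "h 1 = 1" and h_eq_0: "h a = 0 \<longleftrightarrow> a = 0"
begin

lemma fract_lift_Fract:
  assumes "b \<noteq> 0"
  shows "fract_lift h (Fraction_Field.Fract a b) = h a / h b"
proof -
  have "h a' / h b' = h a / h b"
    if "b' \<noteq> 0" "Fraction_Field.Fract a b = Fraction_Field.Fract a' b'" for a' b'
  proof -
    have "a * b' = a' * b" using that assms by (simp add: eq_fract)
    then have "h a * h b' = h a' * h b" by (metis h_mult)
    then show ?thesis using that assms by (simp add: h_eq_0 frac_eq_eq)
  qed
  then show ?thesis
    unfolding fract_lift_def using assms by (intro some_equality) blast+
qed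

lemma fract_lift_add: "fract_lift h (q + r) = fract_lift h q + fract_lift h r"
  and fract_lift_mult: "fract_lift h (q * r) = fract_lift h q * fract_lift h r"
proof -
  obtain a b where q: "q = Fraction_Field.Fract a b" "b \<noteq> 0" by (rule Fract_cases)
  obtain a' b' where r: "r = Fraction_Field.Fract a' b'" "b' \<noteq> 0" by (rule Fract_cases)
  show "fract_lift h (q + r) = fract_lift h q + fract_lift h r"
    using q r by (simp add: fract_lift_Fract h_add h_mult h_eq_0 field_simps)
  show "fract_lift h (q * r) = fract_lift h q * fract_lift h r"
    using q r by (simp add: fract_lift_Fract h_mult)
qed

lemma fract_lift_to_fract: "fract_lift h (to_fract a) = h a"
  by (simp add: to_fract_def fract_lift_Fract h_1)

end

definition poly_to_fls :: "'a::comm_ring_1 poly \<Rightarrow> 'a fls" where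
  "poly_to_fls f = fps_to_fls (fps_of_poly f)"

lemma poly_to_fls_add: "poly_to_fls (f + g) = poly_to_fls f + poly_to_fls g"
  and poly_to_fls_mult: "poly_to_fls (f * g) = poly_to_fls f * poly_to_fls g"
  and poly_to_fls_1: "poly_to_fls 1 = 1" and poly_to_fls_0: "poly_to_fls 0 = 0"
  and poly_to_fls_eq_0_iff: "poly_to_fls f = 0 \<longleftrightarrow> f = 0"
  and poly_to_fls_X: "poly_to_fls [:0, 1:] = fls_X"
  and poly_to_fls_const: "poly_to_fls [:c:] = fls_const c"
  using fps_of_poly_eq_iff[of f 0]
  by (simp_all add: poly_to_fls_def fps_of_poly_add fps_of_poly_mult fls_times_fps_to_fls fps_of_poly_const
      fps_of_poly_fps_X)

definition poly2_to_fls :: "'a::comm_ring_1 poly poly \<Rightarrow> 'a fls fls" where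
  "poly2_to_fls f = fls_map poly_to_fls (poly_to_fls f)"

lemma poly2_to_fls_add: "poly2_to_fls (f + g) = poly2_to_fls f + poly2_to_fls g"
  unfolding poly2_to_fls_def poly_to_fls_add by (rule fls_imap_add) (rule poly_to_fls_add)

lemma poly2_to_fls_mult: "poly2_to_fls (f * g) = poly2_to_fls f * poly2_to_fls g"
  unfolding poly2_to_fls_def poly_to_fls_mult
  by (rule fls_imap_times) (rule poly_to_fls_add poly_to_fls_mult)+

lemma poly2_to_fls_1: "poly2_to_fls 1 = 1"
  by (simp add: poly2_to_fls_def poly_to_fls_1 poly_to_fls_0 fls_map_1)

lemma poly2_to_fls_eq_0_iff: "poly2_to_fls f = 0 \<longleftrightarrow> f = 0"
  unfolding poly2_to_fls_def fls_map_eq_0_iff[of poly_to_fls, OF poly_to_fls_eq_0_iff]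
  by (rule poly_to_fls_eq_0_iff)

section \<open>The residue field and the conclusion\<close>

lemma artin_schreier_root:
  assumes "n > 1"
  shows "\<exists>x :: 'a::alg_closed_field. x ^ n = x + 1"
proof -
  define f :: "nat \<Rightarrow> 'a" where "f i = (if i = n then 1 else if i \<le> 1 then - 1 else 0)" for i
  obtain x where "(\<Sum>k\<le>n. f k * x ^ k) = 0"
    using alg_closed[of n f] assms by (auto simp: f_def)
  moreover have "(\<Sum>k\<le>n. f k * x ^ k) = (\<Sum>k\<in>{0, 1, n}. f k * x ^ k)"
    by (rule sum.mono_neutral_right) (use assms in \<open>auto simp: f_def\<close>)
  ultimately show ?thesis
    using assms by (intro exI[of _ x]) (auto simp: f_def algebra_simps eq_neg_iff_add_eq_0)
qed

lemma prime_field_props: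
  assumes p: "prime p" and card: "card (UNIV :: 'k::field set) = p"
  shows "CHAR('k) = p" and "(a :: 'k) ^ p = a"
proof -
  have fin: "finite (UNIV :: 'k set)"
    using p card by (metis card.infinite not_prime_0)
  \<comment> \<open>Translation by \<open>1\<close> permutes the field, so its cardinality is \<open>0\<close> in the field.\<close>
  have "(\<Sum>x\<in>UNIV. x + 1 :: 'k) = (\<Sum>x\<in>UNIV. x)"
    by (rule sum.reindex_bij_witness[of _ "\<lambda>x. x - 1" "\<lambda>x. x + 1"]) auto
  then have p0: "of_nat p = (0 :: 'k)"
    by (simp add: sum.distrib card)
  then show char: "CHAR('k) = p"
    by (rule CHAR_eq_prime[OF p])
  have "inj_on (of_nat :: nat \<Rightarrow> 'k) {..<p}"
  proof (rule inj_onI)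
    fix i j assume ij: "i \<in> {..<p}" "j \<in> {..<p}" "(of_nat i :: 'k) = of_nat j"
    then have "(of_int (int i - int j) :: 'k) = 0" by simp
    then have "int p dvd int i - int j" by (simp only: of_int_eq_0_iff_char_dvd char)
    then have "int i mod int p = int j mod int p" by (simp only: mod_eq_dvd_iff)
    with ij show "i = j" by simp
  qed
  then have "(of_nat :: nat \<Rightarrow> 'k) ` {..<p} = UNIV"
    using card fin by (intro card_subset_eq) (simp_all add: card_image)
  then obtain k where "a = of_nat k" by blast
  then show "a ^ p = a"
    using of_int_power_prime_char[OF p p0, of "int k"] by simp
qed

theorem mainTheorem2:
  fixes p :: nat
  assumes "prime p"
    and "card (UNIV :: 'k::field set) = p"
  shows "\<not> right_linked p (p_symbol p 1 (alpha_rat :: 'k ratfun2))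
                          (p_symbol p 1 (beta_rat :: 'k ratfun2))
      \<and> \<not> right_linked p (p_symbol p 1 (alpha_laurent :: 'k laurent2))
                          (p_symbol p 1 (beta_laurent :: 'k laurent2))"
proof -
  note k = prime_field_props[OF assms]
  have p: "p > 0" "p > 1" using assms(1) by (simp_all add: prime_gt_0_nat prime_gt_1_nat del: One_nat_def)
  have char: "CHAR('k alg_closure) = p" by (simp add: k)
  obtain \<xi> :: "'k alg_closure" where \<xi>: "\<xi> ^ p = \<xi> + 1"
    using artin_schreier_root[OF p(2)] by blast
  let ?ac = "to_ac :: 'k \<Rightarrow> 'k alg_closure"
  let ?\<kappa> = "fls_map (fls_map ?ac)"
  have m: "fls_map ?ac (f + g) = fls_map ?ac f + fls_map ?ac g"
    "fls_map ?ac (f * g) = fls_map ?ac f * fls_map ?ac g"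
    "fls_map ?ac 1 = 1" "fls_map ?ac 0 = 0" "fls_map ?ac fls_X = fls_X" for f g
    by (auto intro!: fls_imap_add fls_imap_times fls_map_1 fls_map_0 fls_map_X)
  have \<kappa>: "?\<kappa> (f + g) = ?\<kappa> f + ?\<kappa> g" "?\<kappa> (f * g) = ?\<kappa> f * ?\<kappa> g" "?\<kappa> 1 = 1"
    "?\<kappa> (fls_const fls_X) = fls_const fls_X" "?\<kappa> fls_X = fls_X" for f g
    using m by (auto intro!: fls_imap_add fls_imap_times fls_map_1 fls_map_X simp: fls_map_const)
  have frob: "fls_map (fls_map (\<lambda>a. a ^ p)) (?\<kappa> f) = ?\<kappa> f" for f
    by (intro fls_eqI) (simp add: fls_imap_nth fls_map_0 p zero_power k flip: to_ac_power)
  let ?\<iota> = "fract_lift (poly2_to_fls :: 'k poly poly \<Rightarrow> 'k laurent2)"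
  note lift = fract_lift_add fract_lift_mult fract_lift_to_fract
  note lift_rat = lift[OF poly2_to_fls_add poly2_to_fls_mult poly2_to_fls_1 poly2_to_fls_eq_0_iff]
  have "\<not> right_linked p (p_symbol p 1 (alpha_laurent :: 'k laurent2)) (p_symbol p 1 beta_laurent)"
    by (rule not_right_linked_of_embedding[OF assms(1) char \<xi>, of ?\<kappa>])
      (simp_all add: \<kappa> frob alpha_laurent_def beta_laurent_def)
  moreover have "\<not> right_linked p (p_symbol p 1 (alpha_rat :: 'k ratfun2)) (p_symbol p 1 beta_rat)"
  proof (rule not_right_linked_of_embedding[OF assms(1) char \<xi>, of "\<lambda>q. ?\<kappa> (?\<iota> q)"])
    show "?\<kappa> (?\<iota> 1) = 1"
      using lift_rat(3)[of "1 :: 'k poly poly"] by (simp add: poly2_to_fls_1 \<kappa>)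
    show "?\<kappa> (?\<iota> alpha_rat) = fls_const fls_X"
      by (simp add: alpha_rat_def lift_rat poly2_to_fls_def poly_to_fls_const poly_to_fls_X poly_to_fls_0 fls_map_const \<kappa>)
    show "?\<kappa> (?\<iota> beta_rat) = fls_X"
      by (simp add: beta_rat_def lift_rat poly2_to_fls_def poly_to_fls_1 poly_to_fls_X poly_to_fls_0 fls_map_X \<kappa>)
  qed (simp_all only: lift_rat \<kappa> frob)
  ultimately show ?thesis by blast
qed

end
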